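(* Let $m\ge 1$ be an integer. For any tree $T$ of order $m$, every super edge-connected cograph $G$ with $\delta(G)\ge m+2$ contains a subtree $T'\cong T$ such that $G-V(T')$ is super edge-connected.
   Context: Graphs are finite, simple and undirected. The order of a graph is its number of vertices; $\delta(G)$ is the minimum degree; $N_G(v)$ is the set of neighbours of $v$. Cographs are defined recursively: $K_1$ is a cograph; the disjoint union of cographs is a cograph; the join of cographs is a cograph, where the join $G_1+G_2$ of vertex-disjoint graphs is obtained from their disjoint union by adding all edges between $V(G_1)$ and $V(G_2)$. (Equivalently, cographs are the graphs with no induced path $P_4$ on four vertices.) The edge-connectivity $\lambda(G)$ is the minimum number of edges whose removal from $G$ results in a disconnected graph or a trivial graph (a graph of order 1). An edge-cut of a connected graph $G$ is a set $F\subseteq E(G)$ such that $G-F$ is disconnected. A connected graph $G$ is super edge-connected if every minimum edge-cut isolates a vertex, i.e., for every edge-cut $F$ with $|F|=\lambda(G)$ there is a vertex $v$ of degree $\delta(G)$ such that $F=\{vw : w\in N_G(v)\}$. A disconnected graph is defined to be super edge-connected if it has only one isolated vertex (exactly one vertex of degree 0). For a proper subset $S\subsetneq V(G)$, $G-S$ is the graph obtained by deleting all vertices of $S$. A subtree of $G$ is a (not necessarily induced) subgraph that is a tree. *)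

theory Defs
  imports Main
begin

datatype 'a sgraph = SGraph (vertices: "'a set") (edges: "'a set set")

text \<open>Graphs have at least one vertex.\<close>

definition simple_graph :: "'a sgraph \<Rightarrow> bool" where
  "simple_graph G \<longleftrightarrow>
     finite (vertices G) \<and> vertices G \<noteq> {} \<and>
     (\<forall>e\<in>edges G. e \<subseteq> vertices G \<and> card e = 2)"

definition graph_order :: "'a sgraph \<Rightarrow> nat" where
  "graph_order G = card (vertices G)"

definition neighbours :: "'a sgraph \<Rightarrow> 'a \<Rightarrow> 'a set" where
  "neighbours G v = {w. {v, w} \<in> edges G}"

definition vertex_degree :: "'a sgraph \<Rightarrow> 'a \<Rightarrow> nat" where
  "vertex_degree G v = card (neighbours G v)"

definition min_degree :: "'a sgraph \<Rightarrow> nat" where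
  "min_degree G = Min (vertex_degree G ` vertices G)"

definition delete_edges :: "'a sgraph \<Rightarrow> 'a set set \<Rightarrow> 'a sgraph" where
  "delete_edges G F = SGraph (vertices G) (edges G - F)"

definition delete_vertices :: "'a sgraph \<Rightarrow> 'a set \<Rightarrow> 'a sgraph" where
  "delete_vertices G S = SGraph (vertices G - S) {e \<in> edges G. e \<inter> S = {}}"

definition graph_connected :: "'a sgraph \<Rightarrow> bool" where
  "graph_connected G \<longleftrightarrow>
     vertices G \<noteq> {} \<and>
     (\<forall>u\<in>vertices G. \<forall>v\<in>vertices G. (u, v) \<in> {(x, y). {x, y} \<in> edges G}\<^sup>*)"

definition is_cycle :: "'a sgraph \<Rightarrow> 'a list \<Rightarrow> bool" where
  "is_cycle G p \<longleftrightarrow>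
     3 \<le> length p \<and> distinct p \<and>
     (\<forall>i<length p. {p ! i, p ! (Suc i mod length p)} \<in> edges G)"

definition is_tree :: "'a sgraph \<Rightarrow> bool" where
  "is_tree G \<longleftrightarrow> simple_graph G \<and> graph_connected G \<and> (\<nexists>p. is_cycle G p)"

definition subgraph_of :: "'a sgraph \<Rightarrow> 'a sgraph \<Rightarrow> bool" where
  "subgraph_of H G \<longleftrightarrow> vertices H \<subseteq> vertices G \<and> edges H \<subseteq> edges G"

definition graph_isomorphic :: "'a sgraph \<Rightarrow> 'b sgraph \<Rightarrow> bool" where
  "graph_isomorphic G H \<longleftrightarrow>
     (\<exists>f. bij_betw f (vertices G) (vertices H) \<and>
          (\<forall>u\<in>vertices G. \<forall>v\<in>vertices G. {u, v} \<in> edges G \<longleftrightarrow> {f u, f v} \<in> edges H))"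

definition disjoint_union :: "'a sgraph \<Rightarrow> 'a sgraph \<Rightarrow> 'a sgraph" where
  "disjoint_union G H = SGraph (vertices G \<union> vertices H) (edges G \<union> edges H)"

definition graph_join :: "'a sgraph \<Rightarrow> 'a sgraph \<Rightarrow> 'a sgraph" where
  "graph_join G H =
     SGraph (vertices G \<union> vertices H)
       (edges G \<union> edges H \<union> {{u, v} |u v. u \<in> vertices G \<and> v \<in> vertices H})"

inductive cograph :: "'a sgraph \<Rightarrow> bool" where
  single: "cograph (SGraph {v} {})"
| union: "cograph G \<Longrightarrow> cograph H \<Longrightarrow> vertices G \<inter> vertices H = {} \<Longrightarrow>
    cograph (disjoint_union G H)"
| join: "cograph G \<Longrightarrow> cograph H \<Longrightarrow> vertices G \<inter> vertices H = {} \<Longrightarrow>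
    cograph (graph_join G H)"

definition edge_connectivity :: "'a sgraph \<Rightarrow> nat" where
  "edge_connectivity G =
     (LEAST k. \<exists>F\<subseteq>edges G. card F = k \<and>
        (\<not> graph_connected (delete_edges G F) \<or> graph_order (delete_edges G F) = 1))"

definition edge_cut :: "'a sgraph \<Rightarrow> 'a set set \<Rightarrow> bool" where
  "edge_cut G F \<longleftrightarrow> F \<subseteq> edges G \<and> \<not> graph_connected (delete_edges G F)"

text \<open>A disconnected graph counts as super edge-connected iff it has exactly one isolated vertex.\<close>

definition super_edge_connected :: "'a sgraph \<Rightarrow> bool" where
  "super_edge_connected G \<longleftrightarrow>
     (if graph_connected G
      then \<forall>F. edge_cut G F \<and> card F = edge_connectivity G \<longrightarrow>
             (\<exists>v\<in>vertices G. vertex_degree G v = min_degree G \<and>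
                F = {{v, w} |w. w \<in> neighbours G v})
      else \<exists>!v. v \<in> vertices G \<and> vertex_degree G v = 0)"

lemma cograph_simple_graph: "cograph G \<Longrightarrow> simple_graph G"
proof (induction rule: cograph.induct)
  case (join G H)
  then have "u \<noteq> v" if "u \<in> vertices G" "v \<in> vertices H" for u v
    using that by blast
  with join show ?case
    by (fastforce simp: simple_graph_def graph_join_def card_2_iff)
qed (auto simp: simple_graph_def disjoint_union_def)

end

(* A graph of diameter at most 2 fails to be super edge-connected only if it contains a clique D,
   of size equal to the minimum degree, each of whose vertices has exactly one neighbour outside D:
   on one side X of a small edge cut every vertex has a neighbour across, and counting edges forces
   |X| = 1 or X = D. Hence a graph with a universal vertex b such that G - b is connected is super
   edge-connected, and so is a join of two parts with at least two vertices each, if the order is at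
   least 5.

   G is connected, hence a join. The tree is embedded greedily except for one leaf, away from a few
   reserved vertices; if the leaf cannot be placed outside them, then it can be placed on any of
   them. If G has a universal vertex b, then the tree is taken from G - b, or from a component of
   G - b containing a vertex of minimum degree, so that the component remains connected. Otherwise
   two vertices are reserved on each side of the join, unless |G| = m + 4; then G is complete up to
   a perfect matching, and placing the leaf suitably leaves a universal vertex. *)

theory Submission
  imports Defs
begin

section \<open>Connectedness and cographs\<close>

text \<open>The degree bound fits the greedy embedding: with a set \<open>K\<close> reserved, that
  embedding needs degree \<open>m + card K - 2\<close>. Four reserved vertices, two on each side of
  a join, ask for degree \<open>m + 2\<close>. Beside a universal cut vertex \<open>b\<close>,
  degrees inside a component of \<open>G - b\<close> drop by one, but three reserved vertices
  suffice: a nonadjacent pair and one vertex across the join. A join of two pairs may be a 4-cycle,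
  where two opposite edges form a minimum cut isolating no vertex. This is the origin of the bound
  5, and of the special order \<open>m + 4\<close>, the least possible without a universal vertex.
  The danger when \<open>b\<close> is a cut vertex is that the deletion raises the minimum degree: a
  clique component of \<open>G - b\<close> that was too large to obstruct in \<open>G\<close> may
  then obstruct. So some vertex of low degree has to survive, and the component that loses the tree
  must not shrink to a clique. Cographs enter through a hereditary split: every set of at least two
  vertices falls into two parts with all or no edges between them.\<close>

text \<open>The cut form of connectedness, for a neighbourhood function on a set, covers induced
  subgraphs and edge-deleted graphs alike without constructing them.\<close>

definition connected_on :: "('a \<Rightarrow> 'a set) \<Rightarrow> 'a set \<Rightarrow> bool" where
  "connected_on N S \<longleftrightarrow> S \<noteq> {} \<and>
     (\<forall>P\<subseteq>S. P \<noteq> {} \<longrightarrow> P \<noteq> S \<longrightarrow> (\<exists>x\<in>P. \<exists>y\<in>S - P. y \<in> N x))"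

lemma mem_neighbours: "w \<in> neighbours G v \<longleftrightarrow> {v, w} \<in> edges G"
  by (simp add: neighbours_def)

lemma neighbours_sym: "w \<in> neighbours G v \<Longrightarrow> v \<in> neighbours G w"
  by (simp add: mem_neighbours insert_commute)

lemma neighbours_irrefl: "simple_graph G \<Longrightarrow> v \<notin> neighbours G v"
  by (force simp: mem_neighbours simple_graph_def)

lemma neighbours_subset: "simple_graph G \<Longrightarrow> neighbours G v \<subseteq> vertices G"
  by (force simp: mem_neighbours simple_graph_def)

lemma rtrancl_closed_set:
  assumes "(u, v) \<in> {(x, y). {x, y} \<in> E}\<^sup>*" "u \<in> P"
    and "\<And>x y. x \<in> P \<Longrightarrow> {x, y} \<in> E \<Longrightarrow> y \<in> P"
  shows "v \<in> P"
  using assms by (induction rule: rtrancl_induct) auto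

text \<open>A set that no edge leaves is closed under reachability, and conversely the set reachable
  from \<open>u\<close> is left by no edge.\<close>

lemma graph_connected_iff:
  assumes "\<And>e. e \<in> edges G \<Longrightarrow> e \<subseteq> vertices G"
  shows "graph_connected G \<longleftrightarrow> connected_on (neighbours G) (vertices G)"
proof
  assume con: "graph_connected G"
  show "connected_on (neighbours G) (vertices G)"
    unfolding connected_on_def
  proof (intro conjI allI impI)
    show "vertices G \<noteq> {}" using con by (simp add: graph_connected_def)
  next
    fix P assume P: "P \<subseteq> vertices G" "P \<noteq> {}" "P \<noteq> vertices G"
    then obtain u v where uv: "u \<in> P" "v \<in> vertices G" "v \<notin> P" by blast
    have "(u, v) \<in> {(x, y). {x, y} \<in> edges G}\<^sup>*"
      using con uv P by (auto simp: graph_connected_def)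
    then show "\<exists>x\<in>P. \<exists>y\<in>vertices G - P. y \<in> neighbours G x"
      using rtrancl_closed_set[of u v "edges G" P] uv assms by (auto simp: mem_neighbours)
  qed
next
  assume con: "connected_on (neighbours G) (vertices G)"
  show "graph_connected G"
    unfolding graph_connected_def
  proof (intro conjI ballI)
    show "vertices G \<noteq> {}" using con by (simp add: connected_on_def)
  next
    fix u v assume uv: "u \<in> vertices G" "v \<in> vertices G"
    let ?R = "{(x, y). {x, y} \<in> edges G}"
    let ?P = "{w \<in> vertices G. (u, w) \<in> ?R\<^sup>*}"
    have "\<not> (\<exists>x\<in>?P. \<exists>y\<in>vertices G - ?P. y \<in> neighbours G x)"
      by (auto simp: mem_neighbours dest: rtrancl_into_rtrancl)
    moreover have "?P \<noteq> {}" using uv by blast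
    ultimately have "?P = vertices G"
      using con unfolding connected_on_def by blast
    then show "(u, v) \<in> ?R\<^sup>*" using uv by blast
  qed
qed

lemma simple_graph_connected_iff:
  "simple_graph G \<Longrightarrow> graph_connected G \<longleftrightarrow> connected_on (neighbours G) (vertices G)"
  by (rule graph_connected_iff) (auto simp: simple_graph_def)

lemma connected_on_join:
  assumes "P \<noteq> {}" "Q \<noteq> {}" "S = P \<union> Q"
    and "\<And>x y. x \<in> P \<Longrightarrow> y \<in> Q \<Longrightarrow> y \<in> N x \<and> x \<in> N y"
  shows "connected_on N S"
  unfolding connected_on_def
proof (intro conjI allI impI)
  show "S \<noteq> {}" using assms by blast
next
  fix A assume A: "A \<subseteq> S" "A \<noteq> {}" "A \<noteq> S"
  obtain x y where x: "x \<in> A" and y: "y \<in> S" "y \<notin> A" using A by blast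
  obtain p q where pq: "p \<in> P" "q \<in> Q" using assms by blast
  consider "x \<in> P" "y \<in> Q" | "x \<in> Q" "y \<in> P" | "x \<in> P" "y \<in> P" | "x \<in> Q" "y \<in> Q"
    using x y A assms(3) by blast
  then show "\<exists>x\<in>A. \<exists>y\<in>S - A. y \<in> N x"
  proof cases
    \<comment> \<open>For \<open>x\<close> and \<open>y\<close> on the same side, a vertex of the
      other side is adjacent to both; whether or not it lies in \<open>A\<close>, one of these two
      edges leaves \<open>A\<close>.\<close>
    case 3 then show ?thesis using assms(3,4) pq x y by (cases "q \<in> A") blast+
  next
    case 4 then show ?thesis using assms(3,4) pq x y by (cases "p \<in> A") blast+
  qed (use assms(3,4) x y in blast)+
qed

text \<open>Lets \<open>neighbours G\<close> stand in for the neighbourhoods of a vertex-deleted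
  graph.\<close>

lemma connected_on_cong:
  assumes "\<And>x. x \<in> S \<Longrightarrow> N x \<inter> S = M x \<inter> S"
  shows "connected_on N S \<longleftrightarrow> connected_on M S"
proof -
  have "(\<exists>x\<in>P. \<exists>y\<in>S - P. y \<in> N x) \<longleftrightarrow> (\<exists>x\<in>P. \<exists>y\<in>S - P. y \<in> M x)" if "P \<subseteq> S" for P
    using that assms by blast
  then show ?thesis unfolding connected_on_def by simp
qed

text \<open>A smallest neighbour-closed subset containing \<open>z\<close> works: if no edge crossed
  some bipartition of it, the part holding \<open>z\<close> would be closed and smaller.\<close>

lemma component_exists:
  assumes "finite S" "z \<in> S" and sym: "\<And>x y. y \<in> N x \<Longrightarrow> x \<in> N y"
  shows "\<exists>C\<subseteq>S. z \<in> C \<and> connected_on N C \<and> (\<forall>x\<in>C. N x \<inter> S \<subseteq> C)"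
proof -
  let ?closed = "\<lambda>C. C \<subseteq> S \<and> z \<in> C \<and> (\<forall>x\<in>C. N x \<inter> S \<subseteq> C)"
  have "?closed S" using assms by blast
  then obtain C where C: "?closed C" and least: "\<And>D. ?closed D \<Longrightarrow> card C \<le> card D"
    using ex_has_least_nat[of ?closed S card] by metis
  have "finite C" using C assms(1) finite_subset by blast
  have "connected_on N C"
    unfolding connected_on_def
  proof (intro conjI allI impI)
    show "C \<noteq> {}" using C by blast
  next
    fix P assume P: "P \<subseteq> C" "P \<noteq> {}" "P \<noteq> C"
    show "\<exists>x\<in>P. \<exists>y\<in>C - P. y \<in> N x"
    proof (rule ccontr)
      assume no: "\<not> ?thesis"
      define D where "D = (if z \<in> P then P else C - P)"
      have closed: "?closed D"
      proof (cases "z \<in> P")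
        case True
        have "N x \<inter> S \<subseteq> P" if "x \<in> P" for x
        proof
          fix y assume y: "y \<in> N x \<inter> S"
          then have "y \<in> C" using C P that by blast
          then show "y \<in> P" using no that y by blast
        qed
        then show ?thesis using True C P unfolding D_def by auto
      next
        case False
        have "N x \<inter> S \<subseteq> C - P" if "x \<in> C - P" for x
        proof
          fix y assume y: "y \<in> N x \<inter> S"
          then have "y \<in> C" using C that by blast
          moreover have "x \<in> N y" using y sym by blast
          ultimately show "y \<in> C - P" using no that by blast
        qed
        then show ?thesis using False C unfolding D_def by auto
      qed
      have "D \<subset> C" using P unfolding D_def by auto
      then have "card D < card C" by (rule psubset_card_mono[OF \<open>finite C\<close>])
      then show False using least[OF closed] by simp
    qed
  qed
  then show ?thesis using C by blast
qed

text \<open>Quantifying over all \<open>S\<close> makes the induction work: a set meeting both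
  halves of a union or join is split by them, and a set inside one half has the same edges there, so
  the induction hypothesis applies.\<close>

lemma cograph_split:
  assumes "cograph G" "S \<subseteq> vertices G" "2 \<le> card S"
  shows "\<exists>P Q. P \<noteq> {} \<and> Q \<noteq> {} \<and> P \<inter> Q = {} \<and> P \<union> Q = S \<and>
    ((\<forall>x\<in>P. \<forall>y\<in>Q. {x, y} \<in> edges G) \<or> (\<forall>x\<in>P. \<forall>y\<in>Q. {x, y} \<notin> edges G))"
    (is "\<exists>P Q. ?split (edges G) S P Q")
  using assms
proof (induction arbitrary: S rule: cograph.induct)
  case (single v)
  then have "card S \<le> card {v}" by (intro card_mono) auto
  with single show ?case by simp
next
  case (union G H)
  have sub: "\<And>e. e \<in> edges G \<Longrightarrow> e \<subseteq> vertices G" "\<And>e. e \<in> edges H \<Longrightarrow> e \<subseteq> vertices H"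
    using union.hyps cograph_simple_graph by (auto simp: simple_graph_def)
  consider "S \<subseteq> vertices G" | "S \<subseteq> vertices H"
    | "S \<inter> vertices G \<noteq> {}" "S \<inter> vertices H \<noteq> {}" "S \<subseteq> vertices G \<union> vertices H"
    using union.prems by (auto simp: disjoint_union_def)
  then show ?case
  proof cases
    case 1
    then have "{x, y} \<in> edges (disjoint_union G H) \<longleftrightarrow> {x, y} \<in> edges G"
      if "x \<in> S" "y \<in> S" for x y
      using that sub(2)[of "{x, y}"] union.hyps(3) by (auto simp: disjoint_union_def)
    moreover obtain P Q where "?split (edges G) S P Q"
      using union.IH(1)[OF 1 union.prems(2)] by blast
    ultimately have "?split (edges (disjoint_union G H)) S P Q" by (metis UnCI)
    then show ?thesis by blast
  next
    case 2
    then have "{x, y} \<in> edges (disjoint_union G H) \<longleftrightarrow> {x, y} \<in> edges H"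
      if "x \<in> S" "y \<in> S" for x y
      using that sub(1)[of "{x, y}"] union.hyps(3) by (auto simp: disjoint_union_def)
    moreover obtain P Q where "?split (edges H) S P Q"
      using union.IH(2)[OF 2 union.prems(2)] by blast
    ultimately have "?split (edges (disjoint_union G H)) S P Q" by (metis UnCI)
    then show ?thesis by blast
  next
    case 3
    have "{x, y} \<notin> edges (disjoint_union G H)" if "x \<in> vertices G" "y \<in> vertices H" for x y
      using that sub[of "{x, y}"] union.hyps(3) by (auto simp: disjoint_union_def)
    then show ?thesis
      using 3 union.hyps(3)
      by (intro exI[of _ "S \<inter> vertices G"] exI[of _ "S \<inter> vertices H"]) auto
  qed
next
  case (join G H)
  consider "S \<subseteq> vertices G" | "S \<subseteq> vertices H"
    | "S \<inter> vertices G \<noteq> {}" "S \<inter> vertices H \<noteq> {}" "S \<subseteq> vertices G \<union> vertices H"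
    using join.prems by (auto simp: graph_join_def)
  then show ?case
  proof cases
    case 1
    have "e \<subseteq> vertices H" if "e \<in> edges H" for e
      using that join.hyps cograph_simple_graph by (auto simp: simple_graph_def)
    then have "{x, y} \<in> edges (graph_join G H) \<longleftrightarrow> {x, y} \<in> edges G"
      if "x \<in> S" "y \<in> S" for x y
      using that 1 join.hyps(3) by (fastforce simp: graph_join_def doubleton_eq_iff)
    moreover obtain P Q where "?split (edges G) S P Q"
      using join.IH(1)[OF 1 join.prems(2)] by blast
    ultimately have "?split (edges (graph_join G H)) S P Q" by (metis UnCI)
    then show ?thesis by blast
  next
    case 2
    have "e \<subseteq> vertices G" if "e \<in> edges G" for e
      using that join.hyps cograph_simple_graph by (auto simp: simple_graph_def)
    then have "{x, y} \<in> edges (graph_join G H) \<longleftrightarrow> {x, y} \<in> edges H"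
      if "x \<in> S" "y \<in> S" for x y
      using that 2 join.hyps(3) by (fastforce simp: graph_join_def doubleton_eq_iff)
    moreover obtain P Q where "?split (edges H) S P Q"
      using join.IH(2)[OF 2 join.prems(2)] by blast
    ultimately have "?split (edges (graph_join G H)) S P Q" by (metis UnCI)
    then show ?thesis by blast
  next
    case 3
    then show ?thesis
      using join.hyps(3)
      by (intro exI[of _ "S \<inter> vertices G"] exI[of _ "S \<inter> vertices H"])
        (auto simp: graph_join_def)
  qed
qed

section \<open>Embedding trees\<close>

text \<open>Edges are preserved but not reflected, since the subtree need not be induced.\<close>

definition copy_on :: "('a \<Rightarrow> 'a set) \<Rightarrow> 'b sgraph \<Rightarrow> 'a set \<Rightarrow> bool" where
  "copy_on N T R \<longleftrightarrow> (\<exists>f. bij_betw f (vertices T) R \<and>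
     (\<forall>x y. {x, y} \<in> edges T \<longrightarrow> f y \<in> N (f x)))"

text \<open>The end \<open>l\<close> of a longest path is a leaf: a neighbour off the path would
  extend it, and one beyond the second vertex would close a cycle.\<close>

lemma tree_leaf_exists:
  assumes T: "is_tree T" and "2 \<le> graph_order T"
  shows "\<exists>l\<in>vertices T. \<exists>u. neighbours T l = {u}"
proof -
  have simple: "simple_graph T" and con: "connected_on (neighbours T) (vertices T)"
    and acyc: "\<And>p. \<not> is_cycle T p"
    using T by (auto simp: is_tree_def simple_graph_connected_iff)
  have fin: "finite (vertices T)" using simple by (simp add: simple_graph_def)
  define path where "path p \<longleftrightarrow> p \<noteq> [] \<and> distinct p \<and> set p \<subseteq> vertices T \<and>
    (\<forall>i. Suc i < length p \<longrightarrow> {p ! i, p ! Suc i} \<in> edges T)" for p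
  obtain v where "v \<in> vertices T" using simple by (auto simp: simple_graph_def)
  then have "path [v]" by (simp add: path_def)
  moreover have "\<forall>p. path p \<longrightarrow> length p < Suc (card (vertices T))"
    using distinct_card card_mono[OF fin] unfolding path_def by (metis le_imp_less_Suc)
  ultimately have "\<exists>p. path p \<and> (\<forall>q. path q \<longrightarrow> length q \<le> length p)"
    by (rule ex_has_greatest_nat)
  then obtain p where "path p" and longest: "\<And>q. path q \<Longrightarrow> length q \<le> length p"
    by blast
  then have p: "p \<noteq> []" "distinct p" "set p \<subseteq> vertices T"
    "\<And>i. Suc i < length p \<Longrightarrow> {p ! i, p ! Suc i} \<in> edges T"
    by (auto simp: path_def)
  obtain l where l: "l = hd p" "l = p ! 0" "l \<in> set p" "l \<in> vertices T"
    using p by (metis hd_conv_nth hd_in_set subsetD)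
  have on_path: "w \<in> set p" if "w \<in> neighbours T l" for w
  proof (rule ccontr)
    assume "w \<notin> set p"
    have "w \<in> vertices T" using that neighbours_subset[OF simple] by blast
    have "{(w # p) ! i, (w # p) ! Suc i} \<in> edges T" if "Suc i < length (w # p)" for i
      using that p \<open>w \<in> neighbours T l\<close> l
      by (cases i) (auto simp: mem_neighbours insert_commute)
    then have "path (w # p)"
      using p \<open>w \<notin> set p\<close> \<open>w \<in> vertices T\<close> by (simp add: path_def)
    then show False using longest by fastforce
  qed
  have second: "w = p ! 1" if w: "w \<in> neighbours T l" for w
  proof (rule ccontr)
    assume "w \<noteq> p ! 1"
    obtain k where k: "k < length p" "w = p ! k" using on_path[OF w] by (metis in_set_conv_nth)
    have "w \<noteq> l" using w neighbours_irrefl[OF simple] by blast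
    then have "2 \<le> k" using k l \<open>w \<noteq> p ! 1\<close> by (cases k; cases "k - 1") auto
    have "is_cycle T (take (Suc k) p)"
      unfolding is_cycle_def
    proof (intro conjI allI impI)
      show "3 \<le> length (take (Suc k) p)" using k \<open>2 \<le> k\<close> by simp
      show "distinct (take (Suc k) p)" using p by simp
      fix i assume i: "i < length (take (Suc k) p)"
      show "{take (Suc k) p ! i, take (Suc k) p ! (Suc i mod length (take (Suc k) p))} \<in> edges T"
      proof (cases "i = k")
        case True
        then show ?thesis using k l w by (simp add: mem_neighbours insert_commute)
      next
        case False
        then show ?thesis using i k p by simp
      qed
    qed
    then show False using acyc by blast
  qed
  have "card (vertices T) \<noteq> card {l}" using assms(2) by (simp add: graph_order_def)
  then have "{l} \<noteq> vertices T" by metis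
  then obtain w where "w \<in> neighbours T l"
    using con l unfolding connected_on_def by (metis empty_iff empty_subsetI insert_subset singletonD insert_not_empty)
  then show ?thesis using second l by blast
qed

lemma delete_vertices_simps [simp]:
  "vertices (delete_vertices G R) = vertices G - R"
  "edges (delete_vertices G R) = {e \<in> edges G. e \<inter> R = {}}"
  by (simp_all add: delete_vertices_def)

lemma neighbours_delete_vertices:
  "v \<notin> R \<Longrightarrow> neighbours (delete_vertices G R) v = neighbours G v - R"
  by (auto simp: neighbours_def)

lemma simple_graph_delete_vertices:
  "simple_graph G \<Longrightarrow> vertices G - R \<noteq> {} \<Longrightarrow> simple_graph (delete_vertices G R)"
  by (auto simp: simple_graph_def)

lemma tree_delete_leaf:
  assumes T: "is_tree T" and "2 \<le> graph_order T" and l: "l \<in> vertices T" "neighbours T l = {u}"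
  shows "is_tree (delete_vertices T {l})"
proof -
  let ?V = "vertices T - {l}"
  have simple: "simple_graph T" and con: "connected_on (neighbours T) (vertices T)"
    and acyc: "\<And>p. \<not> is_cycle T p"
    using T by (auto simp: is_tree_def simple_graph_connected_iff)
  have "u \<in> ?V"
    using neighbours_subset[OF simple, of l] neighbours_irrefl[OF simple, of l] l by auto
  then have simple': "simple_graph (delete_vertices T {l})"
    using simple by (intro simple_graph_delete_vertices) auto
  have "connected_on (neighbours T) ?V"
    unfolding connected_on_def
  proof (intro conjI allI impI)
    show "?V \<noteq> {}" using \<open>u \<in> ?V\<close> by blast
  next
    fix P assume P: "P \<subseteq> ?V" "P \<noteq> {}" "P \<noteq> ?V"
    \<comment> \<open>Putting \<open>l\<close> on the side of \<open>u\<close> ensures that the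
      crossing edge supplied by the connectedness of \<open>T\<close> is not the pendant
      edge.\<close>
    define P' where "P' = (if u \<in> P then insert l P else P)"
    have "P' \<subseteq> vertices T" "P' \<noteq> {}" "P' \<noteq> vertices T"
      using P l unfolding P'_def by auto
    then obtain x y where "x \<in> P'" "y \<in> vertices T" "y \<notin> P'" "y \<in> neighbours T x"
      using con unfolding connected_on_def by blast
    moreover have "x = u" if "l \<in> neighbours T x" for x
      using neighbours_sym[OF that] l by simp
    ultimately show "\<exists>x\<in>P. \<exists>y\<in>?V - P. y \<in> neighbours T x"
      using l unfolding P'_def by (auto split: if_splits)
  qed
  then have "connected_on (neighbours (delete_vertices T {l})) ?V"
    by (subst connected_on_cong[where M = "neighbours T"]) (auto simp: neighbours_delete_vertices)
  moreover have "\<not> is_cycle (delete_vertices T {l}) p" for p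
    using acyc[of p] by (auto simp: is_cycle_def)
  ultimately show ?thesis
    using simple' by (simp add: is_tree_def simple_graph_connected_iff)
qed

lemma copy_on_add_leaf:
  assumes T: "simple_graph T" and l: "l \<in> vertices T" "neighbours T l = {u}"
    and f: "bij_betw f (vertices T - {l}) R"
      "\<forall>x y. {x, y} \<in> edges T \<longrightarrow> x \<noteq> l \<longrightarrow> y \<noteq> l \<longrightarrow> f y \<in> N (f x)"
    and a: "a \<notin> R" "a \<in> N (f u)" and sym: "\<And>x y. y \<in> N x \<Longrightarrow> x \<in> N y"
  shows "copy_on N T (insert a R)"
proof -
  let ?g = "f(l := a)"
  have "bij_betw ?g (vertices T - {l}) R"
    using f(1) by (rule bij_betw_cong[THEN iffD1, rotated]) auto
  then have "bij_betw ?g (insert l (vertices T - {l})) (insert a R)"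
    using notIn_Un_bij_betw[of l "vertices T - {l}" ?g R] a by simp
  then have "bij_betw ?g (vertices T) (insert a R)" using l by (simp add: insert_absorb)
  moreover have "?g y \<in> N (?g x)" if e: "{x, y} \<in> edges T" for x y
  proof -
    have "x \<noteq> y" using e neighbours_irrefl[OF T] by (auto simp: mem_neighbours)
    moreover have "y \<in> neighbours T x" "x \<in> neighbours T y"
      using e neighbours_sym[of y T x] by (simp_all add: mem_neighbours)
    then have "x = l \<Longrightarrow> y = u" "y = l \<Longrightarrow> x = u" using l by auto
    ultimately show ?thesis using e f(2) a(2) sym by (cases "x = l"; cases "y = l") auto
  qed
  ultimately show ?thesis unfolding copy_on_def by blast
qed

text \<open>Remove a leaf, embed the rest, reattach. Besides the image of \<open>u\<close>, only
  \<open>graph_order T - 2\<close> vertices are occupied, fewer than the neighbours of that image in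
  \<open>S\<close>.\<close>

lemma tree_embeds:
  assumes "is_tree T" "S \<noteq> {}" "\<And>v. v \<in> S \<Longrightarrow> graph_order T \<le> Suc (card (N v \<inter> S))"
    and sym: "\<And>x y. y \<in> N x \<Longrightarrow> x \<in> N y" and irrefl: "\<And>x. x \<notin> N x"
  shows "\<exists>R\<subseteq>S. copy_on N T R"
  using assms(1,3)
proof (induction "graph_order T" arbitrary: T rule: less_induct)
  case less
  have simple: "simple_graph T" using less.prems by (simp add: is_tree_def)
  then have fin: "finite (vertices T)" and ne: "vertices T \<noteq> {}" by (auto simp: simple_graph_def)
  show ?case
  proof (cases "graph_order T = 1")
    case True
    then obtain v where v: "vertices T = {v}" by (auto simp: graph_order_def card_1_singleton_iff)
    obtain s where s: "s \<in> S" using assms(2) by blast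
    have "{x, y} \<notin> edges T" for x y
    proof
      assume "{x, y} \<in> edges T"
      then have "{x, y} \<subseteq> {v}" "card {x, y} = 2" using simple v by (auto simp: simple_graph_def)
      then show False by (auto simp: card_2_iff)
    qed
    then have "copy_on N T {s}"
      unfolding copy_on_def v by (intro exI[of _ "\<lambda>_. s"]) (simp add: bij_betw_def)
    then show ?thesis using s by blast
  next
    case False
    then have two: "2 \<le> graph_order T"
      using fin ne by (metis One_nat_def Suc_leI card_gt_0_iff graph_order_def le_neq_implies_less numeral_2_eq_2)
    obtain l u where l: "l \<in> vertices T" "neighbours T l = {u}"
      using tree_leaf_exists[OF less.prems(1) two] by blast
    let ?T = "delete_vertices T {l}"
    have ord: "Suc (graph_order ?T) = graph_order T"
      using l fin by (simp add: graph_order_def card_Suc_Diff1 del: card_Diff_insert)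
    obtain R where R: "R \<subseteq> S" "copy_on N ?T R"
      using less.hyps[of ?T] tree_delete_leaf[OF less.prems(1) two l] less.prems(2) ord by fastforce
    obtain f where f: "bij_betw f (vertices T - {l}) R"
      "\<forall>x y. {x, y} \<in> edges T \<longrightarrow> x \<noteq> l \<longrightarrow> y \<noteq> l \<longrightarrow> f y \<in> N (f x)"
      using R(2) unfolding copy_on_def by auto
    have "u \<in> vertices T - {l}"
      using neighbours_subset[OF simple, of l] neighbours_irrefl[OF simple, of l] l by auto
    then have fu: "f u \<in> R" using f(1) by (auto simp: bij_betw_def)
    have finR: "finite R" using bij_betw_finite[OF f(1)] fin by simp
    have "card R = graph_order ?T" using bij_betw_same_card[OF f(1)] by (simp add: graph_order_def)
    then have "Suc (Suc (card (R - {f u}))) = graph_order T"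
      using ord card_Suc_Diff1[OF finR fu] by simp
    then have "card (R - {f u}) < card (N (f u) \<inter> S)"
      using less.prems(2)[of "f u"] fu R(1) by auto
    then have "\<not> N (f u) \<inter> S \<subseteq> R - {f u}"
      using card_mono[of "R - {f u}" "N (f u) \<inter> S"] finR by auto
    then obtain a where a: "a \<in> N (f u)" "a \<in> S" "a \<notin> R" using irrefl by blast
    have "copy_on N T (insert a R)"
      by (rule copy_on_add_leaf[where N = N, OF simple l f a(3,1)]) (rule sym)
    then show ?thesis using a R(1) by blast
  qed
qed

text \<open>The last vertex \<open>a\<close> carries a leaf attached to \<open>u\<close>, or the whole tree if that has a single
  vertex.\<close>

lemma tree_embeds_up_to_leaf:
  assumes T: "is_tree T" and "S \<noteq> {}"
    and deg: "\<And>v. v \<in> S \<Longrightarrow> graph_order T \<le> card (N v \<inter> S) + 2"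
    and sym: "\<And>x y. y \<in> N x \<Longrightarrow> x \<in> N y" and irrefl: "\<And>x. x \<notin> N x"
  shows "\<exists>R\<subseteq>S. finite R \<and> Suc (card R) = graph_order T \<and>
    ((\<forall>a. a \<notin> R \<longrightarrow> copy_on N T (insert a R)) \<or>
     (\<exists>u\<in>R. \<forall>a\<in>N u - R. copy_on N T (insert a R)))"
proof -
  have simple: "simple_graph T" using T by (simp add: is_tree_def)
  then have fin: "finite (vertices T)" and ne: "vertices T \<noteq> {}" by (auto simp: simple_graph_def)
  show ?thesis
  proof (cases "graph_order T = 1")
    case True
    have "copy_on N T {s}" for s
    proof -
      have "\<exists>R\<subseteq>{s}. copy_on N T R" using tree_embeds[OF T, of "{s}" N] True sym irrefl by auto
      moreover have "R \<noteq> {}" if "copy_on N T R" for R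
        using that ne by (auto simp: copy_on_def bij_betw_def)
      ultimately show ?thesis by (metis subset_singletonD)
    qed
    then show ?thesis using True by (intro exI[of _ "{}"]) auto
  next
    case False
    then have two: "2 \<le> graph_order T"
      using fin ne by (metis One_nat_def Suc_leI card_gt_0_iff graph_order_def le_neq_implies_less numeral_2_eq_2)
    obtain l u where l: "l \<in> vertices T" "neighbours T l = {u}"
      using tree_leaf_exists[OF T two] by blast
    let ?T = "delete_vertices T {l}"
    have ord: "Suc (graph_order ?T) = graph_order T"
      using l fin by (simp add: graph_order_def card_Suc_Diff1 del: card_Diff_insert)
    \<comment> \<open>One vertex fewer is embedded here, so degrees one below the bound of
      \<open>tree_embeds\<close> for \<open>T\<close> suffice.\<close>
    obtain R where R: "R \<subseteq> S" "copy_on N ?T R"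
      using tree_embeds[OF tree_delete_leaf[OF T two l] assms(2), of N] deg ord sym irrefl
      by fastforce
    obtain f where f: "bij_betw f (vertices T - {l}) R"
      "\<forall>x y. {x, y} \<in> edges T \<longrightarrow> x \<noteq> l \<longrightarrow> y \<noteq> l \<longrightarrow> f y \<in> N (f x)"
      using R(2) unfolding copy_on_def by auto
    have "u \<in> vertices T - {l}"
      using neighbours_subset[OF simple, of l] neighbours_irrefl[OF simple, of l] l by auto
    then have fu: "f u \<in> R" using f(1) by (auto simp: bij_betw_def)
    have finR: "finite R" using bij_betw_finite[OF f(1)] fin by simp
    have "card R = graph_order ?T" using bij_betw_same_card[OF f(1)] by (simp add: graph_order_def)
    moreover have "\<forall>a\<in>N (f u) - R. copy_on N T (insert a R)"
      by (intro ballI copy_on_add_leaf[where N = N, OF simple l f]) (auto intro: sym)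
    ultimately show ?thesis using R(1) finR fu ord by (intro exI[of _ R]) auto
  qed
qed

text \<open>The subtree takes exactly the images of the edges of \<open>T\<close>, not all edges on
  \<open>R\<close>. A cycle in it would be carried back to \<open>T\<close> by the inverse
  bijection.\<close>

lemma copy_on_tree:
  assumes T: "is_tree T" and copy: "copy_on (neighbours G) T R" and "R \<subseteq> vertices G"
  shows "\<exists>T'. is_tree T' \<and> subgraph_of T' G \<and> graph_isomorphic T' T \<and> vertices T' = R"
proof -
  obtain f where f: "bij_betw f (vertices T) R"
    and fe: "\<And>x y. {x, y} \<in> edges T \<Longrightarrow> {f x, f y} \<in> edges G"
    using copy by (auto simp: copy_on_def mem_neighbours)
  have simple: "simple_graph T" and con: "graph_connected T" and acyc: "\<And>p. \<not> is_cycle T p"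
    using T by (auto simp: is_tree_def)
  have pair: "\<exists>x y. e = {x, y} \<and> x \<in> vertices T \<and> y \<in> vertices T \<and> x \<noteq> y" if "e \<in> edges T" for e
    using that simple by (auto simp: simple_graph_def card_2_iff)
  have inj: "inj_on f (vertices T)" and img: "f ` vertices T = R"
    using f by (auto simp: bij_betw_def)
  define T' where "T' = SGraph R ((`) f ` edges T)"
  define g where "g = the_inv_into (vertices T) f"
  have g: "bij_betw g R (vertices T)" unfolding g_def by (rule bij_betw_the_inv_into[OF f])
  have gf: "g (f x) = x" if "x \<in> vertices T" for x
    unfolding g_def using that inj by (rule the_inv_into_f_f[rotated])
  have edge_iff: "{f x, f y} \<in> edges T' \<longleftrightarrow> {x, y} \<in> edges T"
    if "x \<in> vertices T" "y \<in> vertices T" for x y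
  proof
    assume "{f x, f y} \<in> edges T'"
    then obtain e where e: "e \<in> edges T" "f ` {x, y} = f ` e" by (auto simp: T'_def)
    then have "{x, y} = e"
      using inj_on_image_eq_iff[OF inj, of "{x, y}" e] that pair[OF e(1)] by auto
    then show "{x, y} \<in> edges T" using e by simp
  next
    assume "{x, y} \<in> edges T"
    then have "f ` {x, y} \<in> edges T'" unfolding T'_def by (simp del: image_insert)
    then show "{f x, f y} \<in> edges T'" by simp
  qed
  have pair': "\<exists>x y. e = {f x, f y} \<and> x \<in> vertices T \<and> y \<in> vertices T \<and> x \<noteq> y"
    if e: "e \<in> edges T'" for e
  proof -
    obtain d where d: "d \<in> edges T" "e = f ` d" using e by (auto simp: T'_def)
    obtain x y where "d = {x, y}" "x \<in> vertices T" "y \<in> vertices T" "x \<noteq> y"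
      using pair[OF d(1)] by blast
    then show ?thesis using d(2) by (intro exI[of _ x] exI[of _ y]) simp
  qed
  have edge_vert: "x \<in> R \<and> y \<in> R" if "{x, y} \<in> edges T'" for x y
    using pair'[OF that] img by (auto simp: doubleton_eq_iff)
  have edge_g: "{x, y} \<in> edges T' \<Longrightarrow> {g x, g y} \<in> edges T" for x y
  proof -
    assume e: "{x, y} \<in> edges T'"
    then obtain a b where "x = f a" "y = f b" "a \<in> vertices T" "b \<in> vertices T"
      using edge_vert[OF e] img by blast
    then show ?thesis using e edge_iff gf by simp
  qed
  have verts: "vertices T' = R" by (simp add: T'_def)
  have "simple_graph T'"
    unfolding simple_graph_def
  proof (intro conjI ballI)
    show "finite (vertices T')" "vertices T' \<noteq> {}"
      using simple img by (auto simp: verts simple_graph_def)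
  next
    fix e assume "e \<in> edges T'"
    then obtain x y where xy: "e = {f x, f y}" "x \<in> vertices T" "y \<in> vertices T" "x \<noteq> y"
      using pair' by blast
    then show "e \<subseteq> vertices T'" using img verts by auto
    have "f x \<noteq> f y" using xy inj by (auto simp: inj_on_def)
    then show "card e = 2" using xy by simp
  qed
  moreover have "graph_connected T'"
    unfolding graph_connected_def verts
  proof (intro conjI ballI)
    show "R \<noteq> {}" using simple img by (auto simp: simple_graph_def)
  next
    fix u v assume "u \<in> R" "v \<in> R"
    then obtain x y where xy: "u = f x" "v = f y" "x \<in> vertices T" "y \<in> vertices T"
      using img by blast
    have "(x, y) \<in> {(x, y). {x, y} \<in> edges T}\<^sup>*"
      using con xy by (simp add: graph_connected_def)
    then have "(f x, f y) \<in> {(x, y). {x, y} \<in> edges T'}\<^sup>*"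
    proof (induction rule: rtrancl_induct)
      case (step y z)
      then have "{y, z} \<in> edges T" by simp
      then have "{f y, f z} \<in> edges T'"
        using edge_iff neighbours_subset[OF simple]
        by (metis insert_commute mem_neighbours subsetD)
      then show ?case using step.IH by (auto intro: rtrancl_into_rtrancl)
    qed simp
    then show "(u, v) \<in> {(x, y). {x, y} \<in> edges T'}\<^sup>*" using xy by simp
  qed
  moreover have "\<not> is_cycle T' p" for p
  proof
    assume p: "is_cycle T' p"
    have "x \<in> R" if x: "x \<in> set p" for x
    proof -
      obtain i where "i < length p" "x = p ! i" using x by (metis in_set_conv_nth)
      then show ?thesis using p edge_vert unfolding is_cycle_def by blast
    qed
    then have "set p \<subseteq> R" by blast
    then have "inj_on g (set p)" using g by (auto simp: bij_betw_def intro: inj_on_subset)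
    moreover have "{map g p ! i, map g p ! (Suc i mod length p)} \<in> edges T" if "i < length p" for i
    proof -
      have "Suc i mod length p < length p" using that by (intro mod_less_divisor) auto
      then show ?thesis using that p edge_g by (simp add: is_cycle_def)
    qed
    ultimately have "is_cycle T (map g p)" using p by (simp add: is_cycle_def distinct_map)
    then show False using acyc by blast
  qed
  moreover have "graph_isomorphic T' T"
  proof -
    have "{u, v} \<in> edges T' \<longleftrightarrow> {g u, g v} \<in> edges T" if "u \<in> R" "v \<in> R" for u v
      using that img gf edge_iff by auto
    then show ?thesis using g unfolding graph_isomorphic_def verts by blast
  qed
  moreover have "e \<in> edges G" if e: "e \<in> edges T'" for e
  proof -
    obtain d where d: "d \<in> edges T" "e = f ` d" using e by (auto simp: T'_def)
    obtain x y where "d = {x, y}" using pair[OF d(1)] by blast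
    then show ?thesis using d fe by simp
  qed
  then have "subgraph_of T' G" using assms(3) verts by (auto simp: subgraph_of_def)
  ultimately show ?thesis using verts by (auto simp: is_tree_def)
qed

section \<open>Minimum edge cuts\<close>

lemma min_degree_le: "simple_graph G \<Longrightarrow> v \<in> vertices G \<Longrightarrow> min_degree G \<le> card (neighbours G v)"
  by (simp add: min_degree_def vertex_degree_def simple_graph_def)

lemma min_degree_attained:
  assumes "simple_graph G"
  shows "\<exists>v\<in>vertices G. card (neighbours G v) = min_degree G"
proof -
  have "min_degree G \<in> vertex_degree G ` vertices G"
    unfolding min_degree_def using assms by (intro Min_in) (auto simp: simple_graph_def)
  then show ?thesis by (auto simp: vertex_degree_def)
qed

lemma card_ge_2_distinct:
  assumes "2 \<le> card A"
  shows "\<exists>x\<in>A. \<exists>y\<in>A. x \<noteq> y"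
proof (rule ccontr)
  assume "\<not> ?thesis"
  moreover have "finite A" using assms by (metis card.infinite not_numeral_le_zero)
  ultimately have "card A \<le> Suc 0" by (subst card_le_Suc0_iff_eq) auto
  then show False using assms by simp
qed

text \<open>Let \<open>k = card X\<close>. Every vertex of \<open>X\<close> sends an edge across, so
  \<open>k <= d\<close>, say \<open>d = k + j\<close>. A vertex has at most \<open>k - 1\<close>
  neighbours in \<open>X\<close>, hence at least \<open>j + 1\<close> across, and the total is at
  least \<open>k * (j + 1)\<close>. As it is at most \<open>k + j\<close>, we get
  \<open>k * j <= j\<close>: either \<open>k = 1\<close>, or \<open>j = 0\<close> and all estimates
  are equalities.\<close>

lemma cut_side_cases:
  assumes "finite S" "X \<subseteq> S" "X \<noteq> {}" and irrefl: "\<And>x. x \<notin> N x"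
    and cross: "\<And>x. x \<in> X \<Longrightarrow> N x \<inter> (S - X) \<noteq> {}"
    and deg: "\<And>x. x \<in> X \<Longrightarrow> d \<le> card (N x \<inter> S)"
    and small: "(\<Sum>x\<in>X. card (N x \<inter> (S - X))) \<le> d"
  shows "(\<Sum>x\<in>X. card (N x \<inter> (S - X))) = d"
    and "card X = 1 \<or> card X = d \<and> (\<forall>x\<in>X. X - {x} \<subseteq> N x \<and> card (N x \<inter> (S - X)) = 1)"
proof -
  let ?c = "\<lambda>x. card (N x \<inter> (S - X))"
  have finX: "finite X" using assms finite_subset by blast
  have k: "1 \<le> card X" using finX assms(3) by (simp add: Suc_leI card_gt_0_iff)
  have c1: "1 \<le> ?c x" if "x \<in> X" for x
    using cross[OF that] assms(1) by (simp add: Suc_leI card_gt_0_iff)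
  have inner: "N x \<inter> X \<subseteq> X - {x}" for x using irrefl by blast
  have dc: "d \<le> ?c x + card (N x \<inter> X)" if "x \<in> X" for x
  proof -
    have "N x \<inter> S = (N x \<inter> (S - X)) \<union> (N x \<inter> X)" using assms(2) by blast
    then show ?thesis using deg[OF that] card_Un_le[of "N x \<inter> (S - X)" "N x \<inter> X"] by simp
  qed
  have card_inner: "card (N x \<inter> X) \<le> card X - 1" if "x \<in> X" for x
    using card_mono[OF _ inner[of x]] finX that by simp
  have "card X \<le> sum ?c X" using sum_mono[of X "\<lambda>_. 1" ?c] c1 by simp
  then obtain j where j: "d = card X + j" using small le_Suc_ex le_trans by metis
  have "Suc j \<le> ?c x" if "x \<in> X" for x
    using dc[OF that] card_inner[OF that] j k by simp
  then have "card X * Suc j \<le> sum ?c X" using sum_mono[of X "\<lambda>_. Suc j" ?c] by simp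
  moreover have "j \<le> card X * j" using mult_le_mono1[OF k, of j] by simp
  ultimately show sum: "sum ?c X = d" using small j unfolding mult_Suc_right by linarith
  have "card X * j \<le> 1 * j"
    using \<open>card X * Suc j \<le> sum ?c X\<close> small j unfolding mult_Suc_right by linarith
  then have "j = 0 \<or> card X \<le> 1" unfolding mult_le_cancel2 by blast
  then show "card X = 1 \<or> card X = d \<and> (\<forall>x\<in>X. X - {x} \<subseteq> N x \<and> ?c x = 1)"
  proof
    assume "j = 0"
    have one: "?c x = 1" if "x \<in> X" for x
    proof (rule ccontr)
      assume "?c x \<noteq> 1"
      then have "\<exists>x\<in>X. 1 < ?c x" using c1[OF that] that by force
      then have "(\<Sum>x\<in>X. 1) < sum ?c X" using c1 finX by (intro sum_strict_mono_ex1) auto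
      then show False using sum j \<open>j = 0\<close> by simp
    qed
    have "X - {x} \<subseteq> N x" if "x \<in> X" for x
    proof -
      have "card (X - {x}) \<le> card (N x \<inter> X)"
        using dc[OF that] one[OF that] j that finX by simp
      then have "N x \<inter> X = X - {x}" using inner finX by (intro card_seteq) auto
      then show ?thesis by blast
    qed
    then show ?thesis using one j \<open>j = 0\<close> by simp
  qed (use k in simp)
qed

text \<open>The obstruction: for irreflexive \<open>N\<close>, vertices of \<open>D\<close> have
  degree exactly \<open>card D\<close>, so the edges leaving \<open>D\<close> form a cut as small as
  the star of a vertex of minimum degree. The two size conditions keep this cut from isolating a
  single vertex on either side.\<close>

definition tight_clique :: "('a \<Rightarrow> 'a set) \<Rightarrow> 'a set \<Rightarrow> 'a set \<Rightarrow> bool" where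
  "tight_clique N S D \<longleftrightarrow> D \<subseteq> S \<and> 2 \<le> card D \<and> 2 \<le> card (S - D) \<and>
     (\<forall>v\<in>S. card D \<le> card (N v \<inter> S)) \<and>
     (\<forall>x\<in>D. D - {x} \<subseteq> N x \<and> card (N x \<inter> (S - D)) = 1)"

definition diameter_le_2 :: "('a \<Rightarrow> 'a set) \<Rightarrow> 'a set \<Rightarrow> bool" where
  "diameter_le_2 N S \<longleftrightarrow> (\<forall>x\<in>S. \<forall>y\<in>S. x \<noteq> y \<longrightarrow> y \<in> N x \<or> (\<exists>z\<in>S. z \<in> N x \<and> z \<in> N y))"

definition star :: "'a sgraph \<Rightarrow> 'a \<Rightarrow> 'a set set" where
  "star G v = {{v, w} |w. w \<in> neighbours G v}"

section \<open>Minimum edge cuts in graphs of diameter at most two\<close>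

lemma card_star: "card (star G v) = card (neighbours G v)"
proof -
  have "star G v = (\<lambda>w. {v, w}) ` neighbours G v" by (auto simp: star_def)
  then show ?thesis by (simp add: card_image inj_on_def doubleton_eq_iff)
qed

lemma finite_edges: "simple_graph G \<Longrightarrow> finite (edges G)"
  by (rule finite_subset[of _ "Pow (vertices G)"]) (auto simp: simple_graph_def)

lemma delete_edges_connected_iff:
  assumes "simple_graph G"
  shows "graph_connected (delete_edges G F) \<longleftrightarrow>
    connected_on (\<lambda>v. {w. {v, w} \<in> edges G - F}) (vertices G)"
proof -
  have "neighbours (delete_edges G F) = (\<lambda>v. {w. {v, w} \<in> edges G - F})"
    by (auto simp: neighbours_def delete_edges_def)
  then show ?thesis
    using assms by (subst graph_connected_iff) (auto simp: delete_edges_def simple_graph_def)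
qed

lemma star_edge_cut:
  assumes G: "simple_graph G" and "2 \<le> card (vertices G)" and v: "v \<in> vertices G"
  shows "edge_cut G (star G v)"
proof -
  have "card {v} \<noteq> card (vertices G)" using assms(2) by simp
  then have "{v} \<noteq> vertices G" by metis
  moreover have "w = v" if "{v, w} \<in> edges G - star G v" for w
    using that by (auto simp: star_def mem_neighbours)
  ultimately have "\<not> graph_connected (delete_edges G (star G v))"
    unfolding delete_edges_connected_iff[OF G] connected_on_def using v
    by (metis (no_types, lifting) DiffE empty_subsetI insert_not_empty insert_subset
        mem_Collect_eq singletonD singletonI)
  then show ?thesis by (auto simp: edge_cut_def star_def mem_neighbours)
qed

lemma edge_connectivity_le_min_degree:
  assumes G: "simple_graph G" and "2 \<le> card (vertices G)"
  shows "edge_connectivity G \<le> min_degree G"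
proof -
  obtain v where v: "v \<in> vertices G" "card (neighbours G v) = min_degree G"
    using min_degree_attained[OF G] by blast
  have "edge_cut G (star G v)" by (rule star_edge_cut[OF assms v(1)])
  then show ?thesis
    unfolding edge_connectivity_def
    using card_star[of G v] v
    by (intro Least_le exI[of _ "star G v"]) (simp add: edge_cut_def)
qed

text \<open>On a side all of whose vertices have neighbours across, \<open>cut_side_cases\<close>
  applies: that side is a single vertex or a clique of size \<open>min_degree G\<close>, and
  \<open>F\<close> has no edges besides the crossing ones.\<close>

lemma small_edge_cut_cases:
  assumes G: "simple_graph G" and diam: "diameter_le_2 (neighbours G) (vertices G)"
    and F: "edge_cut G F" "card F \<le> min_degree G"
  shows "card F = min_degree G"
    and "(\<exists>v\<in>vertices G. vertex_degree G v = min_degree G \<and> F = star G v) \<or>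
      (\<exists>D. tight_clique (neighbours G) (vertices G) D)"
proof -
  let ?V = "vertices G" and ?N = "neighbours G"
  have fin: "finite ?V" using G by (simp add: simple_graph_def)
  have "finite F" using F(1) finite_edges[OF G] finite_subset by (auto simp: edge_cut_def)
  have NV: "?N v \<subseteq> ?V" and irrefl: "v \<notin> ?N v" for v
    using neighbours_subset[OF G] neighbours_irrefl[OF G] by auto
  obtain X0 where X0: "X0 \<subseteq> ?V" "X0 \<noteq> {}" "X0 \<noteq> ?V"
    and cut0: "\<And>x y. x \<in> X0 \<Longrightarrow> y \<in> ?V - X0 \<Longrightarrow> y \<in> ?N x \<Longrightarrow> {x, y} \<in> F"
  proof -
    have "?V \<noteq> {}" using G by (simp add: simple_graph_def)
    then show ?thesis
      using F(1) that
      unfolding edge_cut_def delete_edges_connected_iff[OF G] connected_on_def mem_neighbours by blast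
  qed
  obtain X where X: "X \<subseteq> ?V" "X \<noteq> {}" "X \<noteq> ?V"
    and cut: "\<And>x y. x \<in> X \<Longrightarrow> y \<in> ?V - X \<Longrightarrow> y \<in> ?N x \<Longrightarrow> {x, y} \<in> F"
    and cross: "\<And>x. x \<in> X \<Longrightarrow> ?N x \<inter> (?V - X) \<noteq> {}"
  \<comment> \<open>If some \<open>x\<close> in \<open>X0\<close> has no neighbour across, the
    complement is the right side: any \<open>y\<close> in it shares a neighbour with
    \<open>x\<close>, and all neighbours of \<open>x\<close> lie in \<open>X0\<close>.\<close>
  proof (cases "\<forall>x\<in>X0. ?N x \<inter> (?V - X0) \<noteq> {}")
    case True
    then have "?N x \<inter> (?V - X0) \<noteq> {}" if "x \<in> X0" for x using that by blast
    with X0 cut0 show ?thesis by (rule that)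
  next
    case False
    then obtain x where x: "x \<in> X0" "?N x \<inter> (?V - X0) = {}" by blast
    show ?thesis
    proof (rule that[of "?V - X0"])
      show "?V - X0 \<subseteq> ?V" "?V - X0 \<noteq> {}" "?V - X0 \<noteq> ?V" using X0 by blast+
    next
      fix y z assume "y \<in> ?V - X0" "z \<in> ?V - (?V - X0)" "z \<in> ?N y"
      then have "{z, y} \<in> F" using neighbours_sym[of z G y] by (intro cut0) auto
      then show "{y, z} \<in> F" by (simp add: insert_commute)
    next
      fix y assume y: "y \<in> ?V - X0"
      have "y \<notin> ?N x" "x \<noteq> y" "x \<in> ?V" "y \<in> ?V" using x y X0 by blast+
      then obtain z where "z \<in> ?V" "z \<in> ?N x" "z \<in> ?N y"
        using diam unfolding diameter_le_2_def by blast
      then show "?N y \<inter> (?V - (?V - X0)) \<noteq> {}" using x by blast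
    qed
  qed
  let ?cut = "(\<lambda>(x, y). {x, y}) ` (SIGMA x:X. ?N x \<inter> (?V - X))"
  have "inj_on (\<lambda>(x, y). {x, y}) (SIGMA x:X. ?N x \<inter> (?V - X))"
    by (auto simp: inj_on_def doubleton_eq_iff)
  moreover have "finite X" using X fin finite_subset by blast
  ultimately have card_cut: "card ?cut = (\<Sum>x\<in>X. card (?N x \<inter> (?V - X)))"
    using fin by (simp add: card_image)
  have "?cut \<subseteq> F" using cut by auto
  then have "card ?cut \<le> card F" using \<open>finite F\<close> by (rule card_mono[rotated])
  then have small: "(\<Sum>x\<in>X. card (?N x \<inter> (?V - X))) \<le> min_degree G"
    using card_cut F(2) by simp
  have deg: "min_degree G \<le> card (?N x \<inter> ?V)" if "x \<in> X" for x
    using min_degree_le[OF G, of x] X that NV[of x] by (simp add: Int_absorb2 subset_iff)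
  note side = cut_side_cases[OF fin X(1,2) irrefl cross deg small]
  show F_card: "card F = min_degree G"
    using side(1) card_cut \<open>card ?cut \<le> card F\<close> F(2) by simp
  have F_eq: "F = ?cut"
    using card_subset_eq[OF \<open>finite F\<close> \<open>?cut \<subseteq> F\<close>] side(1) card_cut F_card by simp
  \<comment> \<open>A singleton on either side makes \<open>F\<close> the star of that vertex;
    otherwise \<open>X\<close> is a tight clique.\<close>
  consider "card X = 1" | "card (?V - X) = 1" | "2 \<le> card X" "2 \<le> card (?V - X)"
  proof -
    have "card X \<noteq> 0" "card (?V - X) \<noteq> 0" using X \<open>finite X\<close> fin by auto
    then show ?thesis using that by linarith
  qed
  then show "(\<exists>v\<in>?V. vertex_degree G v = min_degree G \<and> F = star G v) \<or>
    (\<exists>D. tight_clique ?N ?V D)"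
  proof cases
    case 1
    then obtain v where v: "X = {v}" by (auto simp: card_1_singleton_iff)
    have "F = star G v" using NV[of v] irrefl[of v] unfolding F_eq v star_def by auto
    then show ?thesis
      using X v F_card card_star[of G v] by (auto simp: vertex_degree_def)
  next
    case 2
    then obtain v where v: "?V - X = {v}" by (auto simp: card_1_singleton_iff)
    have "X \<subseteq> ?N v" using cross neighbours_sym unfolding v by fastforce
    moreover have "w \<in> X" if "w \<in> ?N v" for w
    proof -
      have "w \<notin> ?V - X" using that irrefl[of v] unfolding v by auto
      then show ?thesis using that NV[of v] by blast
    qed
    ultimately have Nv: "?N v = X" by blast
    have "F = star G v"
    proof
      show "F \<subseteq> star G v" unfolding F_eq v star_def using Nv by (auto simp: insert_commute)
      show "star G v \<subseteq> F"
        unfolding star_def Nv using cut v Nv neighbours_sym[of _ G v] by (auto simp: insert_commute)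
    qed
    then show ?thesis
      using v F_card card_star[of G v] by (auto simp: vertex_degree_def)
  next
    case 3
    then have "tight_clique ?N ?V X"
      using side(2) X NV min_degree_le[OF G] unfolding tight_clique_def by (auto simp: Int_absorb2)
    then show ?thesis by blast
  qed
qed

text \<open>Plesnik's theorem. An optimal \<open>F\<close> must disconnect, as the order exceeds 1,
  and no disconnecting set is smaller than the minimum degree by
  \<open>small_edge_cut_cases\<close>.\<close>

lemma edge_connectivity_eq_min_degree:
  assumes G: "simple_graph G" and two: "2 \<le> card (vertices G)"
    and diam: "diameter_le_2 (neighbours G) (vertices G)"
  shows "edge_connectivity G = min_degree G"
proof -
  let ?P = "\<lambda>k. \<exists>F\<subseteq>edges G. card F = k \<and>
    (\<not> graph_connected (delete_edges G F) \<or> graph_order (delete_edges G F) = 1)"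
  obtain v where v: "v \<in> vertices G" using G by (auto simp: simple_graph_def)
  have "?P (card (star G v))"
    using star_edge_cut[OF G two v] by (intro exI[of _ "star G v"]) (simp add: edge_cut_def)
  then have "?P (edge_connectivity G)" unfolding edge_connectivity_def by (rule LeastI)
  then obtain F where "edge_cut G F" "card F = edge_connectivity G"
    using two by (auto simp: edge_cut_def graph_order_def delete_edges_def)
  then show ?thesis
    using small_edge_cut_cases(1)[OF G diam] edge_connectivity_le_min_degree[OF G two] by metis
qed

lemma super_edge_connectedI:
  assumes G: "simple_graph G" and two: "2 \<le> card (vertices G)"
    and con: "connected_on (neighbours G) (vertices G)"
    and diam: "diameter_le_2 (neighbours G) (vertices G)"
    and tight: "\<And>D. \<not> tight_clique (neighbours G) (vertices G) D"
  shows "super_edge_connected G"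
  using small_edge_cut_cases(2)[OF G diam] tight edge_connectivity_le_min_degree[OF G two]
    con simple_graph_connected_iff[OF G]
  unfolding super_edge_connected_def star_def by auto

section \<open>Criteria for graphs with a universal vertex and for joins\<close>

lemma diameter_le_2_universal:
  assumes "b \<in> S" "S - {b} \<subseteq> N b" and sym: "\<And>x y. y \<in> N x \<Longrightarrow> x \<in> N y"
  shows "diameter_le_2 N S"
  unfolding diameter_le_2_def using assms by blast

lemma connected_on_universal:
  assumes "b \<in> S" "S - {b} \<subseteq> N b" and sym: "\<And>x y. y \<in> N x \<Longrightarrow> x \<in> N y"
  shows "connected_on N S"
proof (cases "S = {b}")
  case True
  then show ?thesis by (auto simp: connected_on_def)
next
  case False
  then show ?thesis
    using assms by (intro connected_on_join[of "{b}" "S - {b}"]) blast+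
qed

text \<open>If \<open>b\<close> were in \<open>D\<close>, it would have all of \<open>S - D\<close>,
  at least two vertices, as outside neighbours. So \<open>b\<close> is the one outside neighbour of
  every vertex of \<open>D\<close>; in other words, \<open>D\<close> is a clique component of
  \<open>S - {b}\<close>.\<close>

lemma tight_clique_universal:
  assumes D: "tight_clique N S D" and b: "b \<in> S" "S - {b} \<subseteq> N b"
    and sym: "\<And>x y. y \<in> N x \<Longrightarrow> x \<in> N y"
  shows "b \<notin> D" and "\<And>x. x \<in> D \<Longrightarrow> N x \<inter> (S - D) = {b}"
proof -
  show "b \<notin> D"
  proof
    assume "b \<in> D"
    then have "N b \<inter> (S - D) = S - D" using b by blast
    then show False using D \<open>b \<in> D\<close> unfolding tight_clique_def by auto
  qed
  fix x assume x: "x \<in> D"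
  then obtain y where y: "N x \<inter> (S - D) = {y}"
    using D unfolding tight_clique_def by (metis card_1_singletonE)
  have "b \<in> N x \<inter> (S - D)"
    using x b D sym[of x b] \<open>b \<notin> D\<close> unfolding tight_clique_def by blast
  then show "N x \<inter> (S - D) = {b}" using y by auto
qed

text \<open>A tight clique would be a component of \<open>G - b\<close>, and a proper part of it
  because at least two vertices lie outside the clique.\<close>

lemma super_edge_connected_universal:
  assumes G: "simple_graph G" and b: "b \<in> vertices G" "vertices G - {b} \<subseteq> neighbours G b"
    and con: "connected_on (neighbours G) (vertices G - {b})"
  shows "super_edge_connected G"
proof (rule super_edge_connectedI[OF G])
  let ?V = "vertices G" and ?N = "neighbours G"
  have fin: "finite ?V" using G by (simp add: simple_graph_def)
  obtain c where "c \<in> ?V" "c \<noteq> b" using con by (auto simp: connected_on_def)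
  then have "card {b, c} \<le> card ?V" using fin b by (intro card_mono) auto
  then show "2 \<le> card ?V" using \<open>c \<noteq> b\<close> by simp
  show "connected_on ?N ?V" "diameter_le_2 ?N ?V"
    using connected_on_universal diameter_le_2_universal b neighbours_sym by metis+
  fix D show "\<not> tight_clique ?N ?V D"
  proof
    assume D: "tight_clique ?N ?V D"
    note out = tight_clique_universal[OF D b neighbours_sym]
    have "D \<subseteq> ?V - {b}" "D \<noteq> {}" using D out(1) by (auto simp: tight_clique_def)
    moreover have "D \<noteq> ?V - {b}"
    proof
      assume "D = ?V - {b}"
      then have "?V - D = {b}" using b by blast
      then show False using D by (simp add: tight_clique_def)
    qed
    ultimately obtain x y where "x \<in> D" "y \<in> ?V - {b} - D" "y \<in> ?N x"
      using con unfolding connected_on_def by blast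
    then show False using out(2)[of x] by blast
  qed
qed

text \<open>A vertex of a tight clique \<open>D\<close> sees the whole opposite side, so at most one
  vertex there is outside \<open>D\<close>. This forces \<open>D\<close> to meet both sides and to
  miss exactly one vertex \<open>p\<close> of \<open>P\<close> and one \<open>q\<close> of
  \<open>Q\<close>. The degree condition at \<open>p\<close> and \<open>q\<close> then leaves at
  most one vertex of \<open>D\<close> on each side, hence order at most 4.\<close>

lemma super_edge_connected_join:
  assumes G: "simple_graph G" and PQ: "vertices G = P \<union> Q" "P \<inter> Q = {}"
    and join: "\<And>x y. x \<in> P \<Longrightarrow> y \<in> Q \<Longrightarrow> y \<in> neighbours G x"
    and size: "2 \<le> card P" "2 \<le> card Q" "5 \<le> card (vertices G)"
  shows "super_edge_connected G"
proof (rule super_edge_connectedI[OF G])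
  let ?V = "vertices G" and ?N = "neighbours G"
  have fin: "finite ?V" "finite P" "finite Q" using G PQ by (auto simp: simple_graph_def)
  have join': "x \<in> ?N y" if "x \<in> P" "y \<in> Q" for x y
    using join[OF that] by (rule neighbours_sym)
  have ne: "P \<noteq> {}" "Q \<noteq> {}" using size by auto
  show "2 \<le> card ?V" using size by simp
  show "connected_on ?N ?V"
    using ne PQ(1) by (rule connected_on_join) (use join join' in blast)
  show "diameter_le_2 ?N ?V"
    unfolding diameter_le_2_def PQ(1)
  proof (intro ballI impI)
    fix x y assume xy: "x \<in> P \<union> Q" "y \<in> P \<union> Q"
    obtain p q where "p \<in> P" "q \<in> Q" using ne by blast
    then show "y \<in> ?N x \<or> (\<exists>z\<in>P \<union> Q. z \<in> ?N x \<and> z \<in> ?N y)"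
      using xy join join' by (cases "x \<in> P"; cases "y \<in> P") blast+
  qed
  fix D show "\<not> tight_clique ?N ?V D"
  proof
    assume D: "tight_clique ?N ?V D"
    have DV: "D \<subseteq> P \<union> Q" "2 \<le> card D" "2 \<le> card (?V - D)" and finD: "finite D"
      using D PQ fin by (auto simp: tight_clique_def intro: finite_subset)
    have unique: "card A \<le> 1" if "x \<in> D" "A \<subseteq> ?N x \<inter> (?V - D)" for x A
      using that D card_mono[of "?N x \<inter> (?V - D)" A] fin by (simp add: tight_clique_def)
    have outP: "card (P - D) \<le> 1" if "x \<in> D \<inter> Q" for x
      using that join' PQ by (intro unique[of x]) auto
    have outQ: "card (Q - D) \<le> 1" if "x \<in> D \<inter> P" for x
      using that join PQ by (intro unique[of x]) auto
    have "?V - D = (P - D) \<union> (Q - D)" using PQ by blast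
    then have out: "card (P - D) + card (Q - D) \<ge> 2"
      using DV(3) card_Un_le[of "P - D" "Q - D"] by simp
    have meetP: "D \<inter> P \<noteq> {}"
    proof
      assume "D \<inter> P = {}"
      then have "P - D = P" by blast
      moreover obtain x where "x \<in> D" using DV(2) by fastforce
      ultimately show False using outP[of x] DV(1) \<open>D \<inter> P = {}\<close> size(1) by auto
    qed
    have meetQ: "D \<inter> Q \<noteq> {}"
    proof
      assume "D \<inter> Q = {}"
      then have "Q - D = Q" by blast
      moreover obtain x where "x \<in> D" using DV(2) by fastforce
      ultimately show False using outQ[of x] DV(1) \<open>D \<inter> Q = {}\<close> size(2) by auto
    qed
    have "card (P - D) \<le> 1" "card (Q - D) \<le> 1" using outP outQ meetP meetQ by auto
    then have "card (P - D) = 1" "card (Q - D) = 1" using out by auto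
    then obtain p q where pq: "P - D = {p}" "Q - D = {q}" by (metis card_1_singletonE)
    have V_D: "?V - D = {p, q}" using pq PQ by blast
    have card_D: "card D = card (D \<inter> P) + card (D \<inter> Q)"
    proof -
      have "D = (D \<inter> P) \<union> (D \<inter> Q)" using DV(1) by blast
      moreover have "(D \<inter> P) \<inter> (D \<inter> Q) = {}" using PQ(2) by blast
      ultimately show ?thesis using finD by (metis card_Un_disjoint finite_Int)
    qed
    \<comment> \<open>A vertex of \<open>D\<close> in \<open>P\<close> already has \<open>q\<close>
      as its single outside neighbour.\<close>
    have no_p: "p \<notin> ?N x" if "x \<in> D \<inter> P" for x
    proof
      assume "p \<in> ?N x"
      then have "card {p, q} \<le> 1" using that pq join PQ by (intro unique[of x]) auto
      moreover have "p \<noteq> q" using pq PQ by blast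
      ultimately show False by simp
    qed
    have no_q: "q \<notin> ?N x" if "x \<in> D \<inter> Q" for x
    proof
      assume "q \<in> ?N x"
      then have "card {p, q} \<le> 1" using that pq join' PQ by (intro unique[of x]) auto
      moreover have "p \<noteq> q" using pq PQ by blast
      ultimately show False by simp
    qed
    have irrefl: "x \<notin> ?N x" for x by (rule neighbours_irrefl[OF G])
    have "x \<in> insert q (D \<inter> Q)" if x: "x \<in> ?N p \<inter> ?V" for x
    proof (cases "x \<in> D")
      case True
      then show ?thesis using no_p[of x] neighbours_sym[of x G p] x PQ(1) by auto
    next
      case False
      then have "x \<in> ?V - D" "x \<noteq> p" using x irrefl[of p] by auto
      then show ?thesis using V_D by auto
    qed
    then have "?N p \<inter> ?V \<subseteq> insert q (D \<inter> Q)" by blast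
    then have "card (?N p \<inter> ?V) \<le> card (insert q (D \<inter> Q))"
      using finD by (intro card_mono) auto
    then have "card (?N p \<inter> ?V) \<le> Suc (card (D \<inter> Q))"
      using finD by (simp add: card_insert_if split: if_splits)
    moreover have "card D \<le> card (?N p \<inter> ?V)"
      using D V_D unfolding tight_clique_def by blast
    ultimately have "card (D \<inter> P) \<le> 1" using card_D by simp
    have "x \<in> insert p (D \<inter> P)" if x: "x \<in> ?N q \<inter> ?V" for x
    proof (cases "x \<in> D")
      case True
      then show ?thesis using no_q[of x] neighbours_sym[of x G q] x PQ(1) by auto
    next
      case False
      then have "x \<in> ?V - D" "x \<noteq> q" using x irrefl[of q] by auto
      then show ?thesis using V_D by auto
    qed
    then have "?N q \<inter> ?V \<subseteq> insert p (D \<inter> P)" by blast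
    then have "card (?N q \<inter> ?V) \<le> card (insert p (D \<inter> P))"
      using finD by (intro card_mono) auto
    then have "card (?N q \<inter> ?V) \<le> Suc (card (D \<inter> P))"
      using finD by (simp add: card_insert_if split: if_splits)
    moreover have "card D \<le> card (?N q \<inter> ?V)"
      using D V_D unfolding tight_clique_def by blast
    ultimately have "card (D \<inter> Q) \<le> 1" using card_D by simp
    have "?V = D \<union> {p, q}" using V_D DV(1) PQ by blast
    then have "card ?V \<le> card D + card {p, q}" by (metis card_Un_le)
    also have "\<dots> \<le> 4"
      using card_D \<open>card (D \<inter> P) \<le> 1\<close> \<open>card (D \<inter> Q) \<le> 1\<close> card_insert_le_m1[of 2 "{q}" p] by simp
    finally show False using size(3) by simp
  qed
qed

text \<open>The edges between the clique and the universal vertex would be a minimum edge cut that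
  isolates no vertex.\<close>

lemma super_edge_connected_clique_component:
  assumes G: "simple_graph G" and super: "super_edge_connected G"
    and b: "b \<in> vertices G" "vertices G - {b} \<subseteq> neighbours G b"
    and D: "D \<subset> vertices G - {b}" "2 \<le> card D"
    and closed: "\<And>x. x \<in> D \<Longrightarrow> neighbours G x \<subseteq> insert b D"
  shows "card D \<noteq> min_degree G"
proof
  let ?V = "vertices G" and ?N = "neighbours G"
  assume card_D: "card D = min_degree G"
  have fin: "finite ?V" using G by (simp add: simple_graph_def)
  have two: "2 \<le> card ?V"
    using D(2) card_mono[OF fin, of D] D(1) by fastforce
  define F where "F = (\<lambda>d. {b, d}) ` D"
  have "card F = card D"
    unfolding F_def by (rule card_image) (auto simp: inj_on_def doubleton_eq_iff)
  have "F \<subseteq> edges G" using b D by (auto simp: F_def mem_neighbours[symmetric])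
  have "\<not> connected_on (\<lambda>v. {w. {v, w} \<in> edges G - F}) ?V"
  proof
    assume con: "connected_on (\<lambda>v. {w. {v, w} \<in> edges G - F}) ?V"
    have "D \<subseteq> ?V" "D \<noteq> {}" "D \<noteq> ?V" using D by auto
    then obtain x y where xy: "x \<in> D" "y \<in> ?V - D" "{x, y} \<in> edges G - F"
      using con unfolding connected_on_def by blast
    then have "y \<in> insert b D" using closed[of x] by (auto simp: mem_neighbours)
    then have "y = b" using xy by blast
    then have "{x, y} \<in> F" using xy by (auto simp: F_def insert_commute)
    then show False using xy by blast
  qed
  then have "edge_cut G F"
    using \<open>F \<subseteq> edges G\<close> delete_edges_connected_iff[OF G] by (simp add: edge_cut_def)
  moreover have "card F = edge_connectivity G"
    using edge_connectivity_eq_min_degree[OF G two] diameter_le_2_universal[where N = ?N, OF b neighbours_sym]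
      card_D \<open>card F = card D\<close> by simp
  moreover have "graph_connected G"
    using connected_on_universal[where N = ?N, OF b neighbours_sym] simple_graph_connected_iff[OF G] by simp
  ultimately obtain v where v: "F = {{v, w} |w. w \<in> ?N v}"
    using super unfolding super_edge_connected_def by auto
  \<comment> \<open>The vertex \<open>e\<close> shows that \<open>F\<close> is not the whole star of
    \<open>b\<close>; two edges \<open>{b, c}\<close> and \<open>{b, d}\<close> of \<open>F\<close>
    share no other vertex, so \<open>F\<close> is no other star.\<close>
  obtain e where e: "e \<in> ?V" "e \<noteq> b" "e \<notin> D" using D(1) by blast
  obtain c d where cd: "c \<in> D" "d \<in> D" "c \<noteq> d"
    using card_ge_2_distinct[OF D(2)] by blast
  show False
  proof (cases "v = b")
    case True
    have "e \<in> ?N b" using b e by blast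
    then have "{b, e} \<in> F" using v True by blast
    then show False using e by (auto simp: F_def doubleton_eq_iff)
  next
    case False
    have "v \<in> f" if "f \<in> F" for f using that v by blast
    then have "v \<in> {b, c}" "v \<in> {b, d}" using cd by (auto simp: F_def)
    then show False using False cd by blast
  qed
qed

section \<open>Removing a tree\<close>

lemma copy_on_card: "copy_on N T R \<Longrightarrow> card R = graph_order T"
  by (auto simp: copy_on_def graph_order_def dest: bij_betw_same_card)

lemma tree_order_pos: "is_tree T \<Longrightarrow> 1 \<le> graph_order T"
  by (simp add: is_tree_def simple_graph_def graph_order_def Suc_leI card_gt_0_iff)

text \<open>The degree bound is exact for this alternative: with every free vertex outside
  \<open>K\<close> excluded, \<open>u\<close> has at most \<open>graph_order T - 2\<close>
  neighbours in \<open>R\<close>, so the remaining \<open>card K\<close> or more must exhaust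
  \<open>K\<close>.\<close>

lemma tree_embeds_reserving:
  assumes T: "is_tree T" and C: "finite C" "K \<subset> C"
    and deg: "\<And>v. v \<in> C \<Longrightarrow> graph_order T + card K \<le> card (N v \<inter> C) + 2"
    and sym: "\<And>x y. y \<in> N x \<Longrightarrow> x \<in> N y" and irrefl: "\<And>x. x \<notin> N x"
  shows "\<exists>R\<subseteq>C - K. Suc (card R) = graph_order T \<and>
    ((\<exists>a\<in>C - R - K. copy_on N T (insert a R)) \<or> (\<forall>a\<in>K. copy_on N T (insert a R)))"
proof -
  have finK: "finite K" using C finite_subset by blast
  have deg': "graph_order T \<le> card (N v \<inter> (C - K)) + 2" if "v \<in> C - K" for v
  proof -
    have "card (N v \<inter> C) \<le> card (N v \<inter> (C - K) \<union> K)"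
      using C(1) finK by (intro card_mono) auto
    also have "\<dots> \<le> card (N v \<inter> (C - K)) + card K" by (rule card_Un_le)
    finally show ?thesis using deg[of v] that by simp
  qed
  have "C - K \<noteq> {}" using C(2) by blast
  obtain R where R: "R \<subseteq> C - K" "finite R" "Suc (card R) = graph_order T"
    and ext: "(\<forall>a. a \<notin> R \<longrightarrow> copy_on N T (insert a R)) \<or>
      (\<exists>u\<in>R. \<forall>a\<in>N u - R. copy_on N T (insert a R))"
    using tree_embeds_up_to_leaf[where N = N, OF T \<open>C - K \<noteq> {}\<close> deg' sym irrefl] by meson
  have "(\<exists>a\<in>C - R - K. copy_on N T (insert a R)) \<or> (\<forall>a\<in>K. copy_on N T (insert a R))"
    using ext
  proof
    assume "\<forall>a. a \<notin> R \<longrightarrow> copy_on N T (insert a R)"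
    then show ?thesis using R(1) by blast
  next
    assume "\<exists>u\<in>R. \<forall>a\<in>N u - R. copy_on N T (insert a R)"
    then obtain u where u: "u \<in> R" and ext_u: "\<forall>a\<in>N u - R. copy_on N T (insert a R)" by blast
    show ?thesis
    proof (cases "N u \<inter> (C - R - K) = {}")
      case False
      then show ?thesis using ext_u by blast
    next
      case True
      have "N u \<inter> C \<subseteq> (R - {u}) \<union> (N u \<inter> K)" using True irrefl[of u] by blast
      then have "card (N u \<inter> C) \<le> card ((R - {u}) \<union> (N u \<inter> K))"
        using R(2) finK by (intro card_mono) auto
      also have "\<dots> \<le> card (R - {u}) + card (N u \<inter> K)" by (rule card_Un_le)
      finally have "card K \<le> card (N u \<inter> K)"
        using deg[of u] u R card_Suc_Diff1[OF R(2) u] by auto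
      then have "N u \<inter> K = K" using finK by (intro card_seteq) auto
      then show ?thesis using ext_u R(1) by blast
    qed
  qed
  then show ?thesis using R by blast
qed

text \<open>Prepares the cut vertex case. The surviving nonadjacent pair prevents what is left from
  being a clique; the last clause, applied to a \<open>z\<close> of minimum degree, keeps the new
  minimum degree small.\<close>

lemma tree_removable_from_join:
  assumes T: "is_tree T" and PQ: "finite (P \<union> Q)" "P \<inter> Q = {}" "Q \<noteq> {}"
    and join: "\<And>x y. x \<in> P \<Longrightarrow> y \<in> Q \<Longrightarrow> y \<in> N x"
    and z: "z \<in> P" "z' \<in> P" "z \<noteq> z'" "z' \<notin> N z"
    and deg: "\<And>v. v \<in> P \<union> Q \<Longrightarrow> graph_order T + 1 \<le> card (N v \<inter> (P \<union> Q))"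
    and sym: "\<And>x y. y \<in> N x \<Longrightarrow> x \<in> N y" and irrefl: "\<And>x. x \<notin> N x"
  shows "\<exists>R\<subseteq>P \<union> Q. copy_on N T R \<and> connected_on N (P \<union> Q - R) \<and>
    (\<exists>x\<in>P \<union> Q - R. \<exists>y\<in>P \<union> Q - R. x \<noteq> y \<and> y \<notin> N x) \<and>
    (z \<in> P \<union> Q - R \<or> (\<exists>y\<in>P \<union> Q - R. card (N y \<inter> (P \<union> Q - R)) \<le> 1))"
proof -
  let ?C = "P \<union> Q"
  obtain q where q: "q \<in> Q" using PQ by blast
  \<comment> \<open>The pair \<open>z\<close>, \<open>z'\<close> is the nonadjacent one, and
    \<open>q\<close> keeps the join connected. Three reserved vertices are what degree
    \<open>graph_order T + 1\<close> allows.\<close>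
  let ?K = "{z, z', q}"
  have "z' \<noteq> q" "z \<noteq> q" using z q PQ(2) by blast+
  then have "card ?K = 3" using z by simp
  have "z \<notin> N z'" using z(4) sym by blast
  \<comment> \<open>\<open>z\<close>, \<open>z'\<close> and the neighbours of \<open>z\<close>
    number at least \<open>graph_order T + 3\<close>, so outside \<open>R\<close> there is a vertex
    besides the three reserved ones.\<close>
  have "insert z (insert z' (N z \<inter> ?C)) \<subseteq> ?C" using z by blast
  then have "card (insert z (insert z' (N z \<inter> ?C))) \<le> card ?C"
    using PQ(1) by (intro card_mono)
  then have card_C: "graph_order T + 3 \<le> card ?C"
    using deg[of z] z irrefl[of z] PQ(1) by auto
  then have "card ?K < card ?C" using tree_order_pos[OF T] \<open>card ?K = 3\<close> by simp
  then have "?K \<subset> ?C" using z q by auto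
  have "graph_order T + card ?K \<le> card (N v \<inter> ?C) + 2" if "v \<in> ?C" for v
    using deg[OF that] \<open>card ?K = 3\<close> by simp
  note reserving = tree_embeds_reserving[where N = N and K = ?K, OF T PQ(1) \<open>?K \<subset> ?C\<close> this sym irrefl]
  then obtain R where R: "R \<subseteq> ?C - ?K" "Suc (card R) = graph_order T"
    and ext: "(\<exists>a\<in>?C - R - ?K. copy_on N T (insert a R)) \<or> (\<forall>a\<in>?K. copy_on N T (insert a R))"
    by meson
  have finR: "finite R" using R(1) PQ(1) finite_subset by blast
  have join_connected: "connected_on N (?C - S)" if "P - S \<noteq> {}" "Q - S \<noteq> {}" for S
    using that by (rule connected_on_join) (use join sym in blast)+
  show ?thesis
  proof (cases "\<exists>a\<in>?C - R - ?K. copy_on N T (insert a R)")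
    case True
    then obtain a where a: "a \<in> ?C - R - ?K" "copy_on N T (insert a R)" by blast
    let ?R = "insert a R"
    have "z \<in> P - ?R" "z' \<in> P - ?R" "q \<in> Q - ?R" using a(1) R(1) z q by auto
    then show ?thesis
      using a R(1) z join_connected[of ?R] by (intro exI[of _ ?R]) blast
  next
    case False
    then have copy: "copy_on N T (insert a R)" if "a \<in> ?K" for a using ext that by blast
    have out: "z \<notin> R" "z' \<notin> R" "q \<notin> R" using R(1) by auto
    show ?thesis
    \<comment> \<open>A second vertex of \<open>Q\<close> outside \<open>R\<close> makes
      \<open>q\<close> dispensable. Otherwise the spare vertex \<open>w\<close> lies in
      \<open>P\<close>.\<close>
    proof (cases "Q - R \<subseteq> {q}")
      case False
      let ?R = "insert q R"
      have "z \<in> P - ?R" "z' \<in> P - ?R" "Q - ?R \<noteq> {}"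
        using False out z \<open>z' \<noteq> q\<close> \<open>z \<noteq> q\<close> by auto
      then show ?thesis
        using copy R(1) q z join_connected[of ?R] by (intro exI[of _ ?R]) blast
    next
      case True
      let ?W = "P - R - {z, z'}"
      have "card (?C - R) = card ?C - card R" using R(1) finR by (intro card_Diff_subset) auto
      then have "card ?K < card (?C - R)" using card_C R(2) \<open>card ?K = 3\<close> by simp
      then have "\<not> ?C - R \<subseteq> ?K" using card_mono[of ?K "?C - R"] by auto
      then obtain w where w: "w \<in> ?W" using True by blast
      show ?thesis
      proof (cases "\<exists>x\<in>P - insert z' R. \<exists>y\<in>P - insert z' R. x \<noteq> y \<and> y \<notin> N x")
        case True
        let ?R = "insert z' R"
        have "z \<in> P - ?R" "q \<in> Q - ?R" using out z q \<open>z' \<noteq> q\<close> by auto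
        then show ?thesis
          using True copy R(1) z join_connected[of ?R] by (intro exI[of _ ?R]) blast
      next
        case clique: False
        show ?thesis
        proof (cases "\<exists>y\<in>?W. z' \<in> N y")
          \<comment> \<open>Here \<open>P - insert z' R\<close> is a clique. Giving up
            \<open>q\<close> leaves this clique with \<open>z'\<close> attached through
            \<open>y\<close>, which is connected although the join is lost.\<close>
          case nbr: True
          then obtain y where y: "y \<in> ?W" "z' \<in> N y" by blast
          let ?R = "insert q R"
          have rest: "?C - ?R = insert z' (P - insert z' R)"
            using True z q PQ(2) out by auto
          have "connected_on N (P - insert z' R)"
            using clique out z sym by (intro connected_on_universal[of z]) blast+
          then have "connected_on N (?C - ?R)"
            unfolding rest connected_on_def
          proof (intro conjI allI impI)
            fix A assume con: "P - insert z' R \<noteq> {} \<and> (\<forall>A\<subseteq>P - insert z' R. A \<noteq> {} \<longrightarrow>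
                A \<noteq> P - insert z' R \<longrightarrow> (\<exists>x\<in>A. \<exists>y\<in>P - insert z' R - A. y \<in> N x))"
              and A: "A \<subseteq> insert z' (P - insert z' R)" "A \<noteq> {}"
                "A \<noteq> insert z' (P - insert z' R)"
            show "\<exists>x\<in>A. \<exists>y\<in>insert z' (P - insert z' R) - A. y \<in> N x"
            proof (cases "A - {z'} = {} \<or> A - {z'} = P - insert z' R")
              case True
              have "y \<in> P - insert z' R" "z' \<in> N y" "y \<in> N z'" using y sym by auto
              moreover have "A = {z'} \<or> A = P - insert z' R" using True A by blast
              ultimately show ?thesis by blast
            next
              case False
              moreover have "A - {z'} \<subseteq> P - insert z' R" using A(1) by blast
              ultimately obtain x y where "x \<in> A - {z'}" "y \<in> P - insert z' R - (A - {z'})" "y \<in> N x"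
                using con by meson
              then show ?thesis by blast
            qed
          qed simp
          moreover have "z \<in> ?C - ?R" "z' \<in> ?C - ?R" using z out \<open>z' \<noteq> q\<close> \<open>z \<noteq> q\<close> by auto
          moreover have "?R \<subseteq> ?C" using R(1) q by blast
          ultimately show ?thesis using copy z by (intro exI[of _ ?R]) blast
        next
          case no_nbr: False
          \<comment> \<open>With no neighbour in \<open>?W\<close>, \<open>z'\<close> keeps at most
            the neighbour \<open>q\<close>. Thus \<open>z\<close> can be given up: \<open>z'\<close>
            has degree at most 1 and forms a nonadjacent pair with \<open>w\<close>.\<close>
          let ?R = "insert z R"
          have "N z' \<inter> (?C - ?R) \<subseteq> {q}"
            using no_nbr True sym irrefl[of z'] by blast
          then have "card (N z' \<inter> (?C - ?R)) \<le> 1"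
            using card_mono[of "{q}"] by fastforce
          moreover have "z' \<in> P - ?R" "w \<in> P - ?R" "q \<in> Q - ?R"
            using out z q w \<open>z \<noteq> q\<close> by auto
          moreover have "z' \<notin> N w" "w \<noteq> z'" using no_nbr w by auto
          moreover have "?R \<subseteq> ?C" using R(1) z by blast
          ultimately show ?thesis
            using copy join_connected[of ?R] by (intro exI[of _ ?R]) blast
        qed
      qed
    qed
  qed
qed

text \<open>Two vertices are reserved on each side. If the leaf has to take a reserved one, it takes
  it on the side of a fifth free vertex \<open>w\<close>, which replaces it.\<close>

lemma tree_removable_large_join:
  assumes T: "is_tree T" and PQ: "finite (P \<union> Q)" "P \<inter> Q = {}" "2 \<le> card P" "2 \<le> card Q"
    and large: "graph_order T + 5 \<le> card (P \<union> Q)"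
    and deg: "\<And>v. v \<in> P \<union> Q \<Longrightarrow> graph_order T + 2 \<le> card (N v \<inter> (P \<union> Q))"
    and sym: "\<And>x y. y \<in> N x \<Longrightarrow> x \<in> N y" and irrefl: "\<And>x. x \<notin> N x"
  shows "\<exists>R\<subseteq>P \<union> Q. copy_on N T R \<and> 2 \<le> card (P - R) \<and> 2 \<le> card (Q - R)"
proof -
  let ?C = "P \<union> Q"
  obtain p p' where p: "p \<in> P" "p' \<in> P" "p \<noteq> p'"
    using card_ge_2_distinct[OF PQ(3)] by blast
  obtain q q' where q: "q \<in> Q" "q' \<in> Q" "q \<noteq> q'"
    using card_ge_2_distinct[OF PQ(4)] by blast
  have disj: "p \<noteq> q" "p \<noteq> q'" "p' \<noteq> q" "p' \<noteq> q'" using p q PQ(2) by blast+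
  let ?K = "{p, p', q, q'}"
  have "card ?K = 4" using p q disj by simp
  then have "card ?K < card ?C" using large by simp
  then have "?K \<subset> ?C" using p q by auto
  have "graph_order T + card ?K \<le> card (N v \<inter> ?C) + 2" if "v \<in> ?C" for v
    using deg[OF that] \<open>card ?K = 4\<close> by simp
  note reserving = tree_embeds_reserving[where N = N and K = ?K, OF T PQ(1) \<open>?K \<subset> ?C\<close> this sym irrefl]
  then obtain R where R: "R \<subseteq> ?C - ?K" "Suc (card R) = graph_order T"
    and ext: "(\<exists>a\<in>?C - R - ?K. copy_on N T (insert a R)) \<or> (\<forall>a\<in>?K. copy_on N T (insert a R))"
    by meson
  have fin: "finite R" "finite P" "finite Q" using R(1) PQ(1) finite_subset by auto
  have two: "2 \<le> card A" if "x \<in> A" "y \<in> A" "x \<noteq> y" "finite A" for x y A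
    using that card_mono[of A "{x, y}"] by simp
  have out: "p \<notin> R" "p' \<notin> R" "q \<notin> R" "q' \<notin> R" using R(1) by auto
  have "card (?C - R) = card ?C - card R" using R(1) fin by (intro card_Diff_subset) auto
  then have "card ?K < card (?C - R)" using large R(2) \<open>card ?K = 4\<close> by simp
  then have "\<not> ?C - R \<subseteq> ?K" using card_mono[of ?K "?C - R"] by auto
  then obtain w where w: "w \<in> ?C - R - ?K" by blast
  from ext consider a where "a \<in> ?C - R - ?K" "copy_on N T (insert a R)"
    | "w \<in> P" "copy_on N T (insert p R)" | "w \<in> Q" "copy_on N T (insert q R)"
    using w by blast
  then show ?thesis
  proof cases
    case (1 a)
    then have "2 \<le> card (P - insert a R)" "2 \<le> card (Q - insert a R)"
      using two[of p "P - insert a R" p'] two[of q "Q - insert a R" q'] p q out fin by auto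
    then show ?thesis using 1 R(1) by (intro exI[of _ "insert a R"]) blast
  next
    case 2
    then have "2 \<le> card (P - insert p R)" "2 \<le> card (Q - insert p R)"
      using two[of w "P - insert p R" p'] two[of q "Q - insert p R" q'] p q w disj out fin by auto
    then show ?thesis using 2 R(1) p by (intro exI[of _ "insert p R"]) blast
  next
    case 3
    then have "2 \<le> card (P - insert q R)" "2 \<le> card (Q - insert q R)"
      using two[of p "P - insert q R" p'] two[of w "Q - insert q R" q'] p q w disj out fin by auto
    then show ?thesis using 3 R(1) q by (intro exI[of _ "insert q R"]) blast
  qed
qed

text \<open>Here every vertex has at most one non-neighbour, so \<open>V\<close> is complete up to a matching.
  The remaining four vertices must not form a 4-cycle; this is why the position of a leaf
  is kept free.\<close>

lemma tree_removable_cocktail_party: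
  assumes T: "is_tree T" and V: "finite V" "card V = graph_order T + 4"
    and deg: "\<And>v. v \<in> V \<Longrightarrow> graph_order T + 2 \<le> card (N v \<inter> V)"
    and sym: "\<And>x y. y \<in> N x \<Longrightarrow> x \<in> N y" and irrefl: "\<And>x. x \<notin> N x"
  shows "\<exists>R\<subseteq>V. copy_on N T R \<and> (\<exists>b\<in>V - R. V - R - {b} \<subseteq> N b \<and> connected_on N (V - R - {b}))"
proof -
  \<comment> \<open>Two non-neighbours would leave degree at most \<open>card V - 3\<close>, one
    below the bound.\<close>
  have unique: "y = y'"
    if "x \<in> V" "y \<in> V" "y' \<in> V" "y \<noteq> x" "y' \<noteq> x" "y \<notin> N x" "y' \<notin> N x" for x y y'
  proof (rule ccontr)
    assume "y \<noteq> y'"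
    then have "card {x, y, y'} = 3" using that by auto
    moreover have "card (N x \<inter> V \<union> {x, y, y'}) \<le> card V"
      using V(1) that by (intro card_mono) auto
    moreover have "card (N x \<inter> V \<union> {x, y, y'}) = card (N x \<inter> V) + card {x, y, y'}"
      using that irrefl V(1) by (intro card_Un_disjoint) auto
    ultimately show False using deg[OF that(1)] V(2) by simp
  qed
  have "V \<noteq> {}" using V(2) by auto
  have deg': "graph_order T \<le> card (N v \<inter> V) + 2" if "v \<in> V" for v using deg[OF that] by simp
  obtain R where R: "R \<subseteq> V" "finite R" "Suc (card R) = graph_order T"
    and ext: "(\<forall>a. a \<notin> R \<longrightarrow> copy_on N T (insert a R)) \<or>
      (\<exists>u\<in>R. \<forall>a\<in>N u - R. copy_on N T (insert a R))"
    using tree_embeds_up_to_leaf[where N = N, OF T \<open>V \<noteq> {}\<close> deg' sym irrefl] by meson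
  \<comment> \<open>The vertex \<open>u\<close> has at least \<open>graph_order T + 2\<close>
    neighbours and \<open>R\<close> has \<open>graph_order T - 1\<close> elements, so the leaf has
    at least two possible positions.\<close>
  have "\<exists>A\<subseteq>V - R. 2 \<le> card A \<and> (\<forall>a\<in>A. copy_on N T (insert a R))"
    using ext
  proof
    assume "\<forall>a. a \<notin> R \<longrightarrow> copy_on N T (insert a R)"
    moreover have "2 \<le> card (V - R)" using R V card_Diff_subset[OF R(2,1)] by simp
    ultimately show ?thesis by (intro exI[of _ "V - R"]) auto
  next
    assume "\<exists>u\<in>R. \<forall>a\<in>N u - R. copy_on N T (insert a R)"
    then obtain u where u: "u \<in> R" "\<forall>a\<in>N u - R. copy_on N T (insert a R)" by blast
    have "card (N u \<inter> V) - card R \<le> card (N u \<inter> V - R)" using R(2) by (rule diff_card_le_card_Diff)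
    moreover have "graph_order T + 2 \<le> card (N u \<inter> V)" using deg u(1) R(1) by blast
    ultimately have "2 \<le> card (N u \<inter> V - R)" using R(3) by simp
    then show ?thesis using u by (intro exI[of _ "N u \<inter> V - R"]) auto
  qed
  then obtain A where A: "A \<subseteq> V - R" "2 \<le> card A" "\<forall>a\<in>A. copy_on N T (insert a R)" by blast
  obtain a a' where a: "a \<in> A" "a' \<in> A" "a \<noteq> a'"
    using card_ge_2_distinct[OF A(2)] by blast
  \<comment> \<open>If deleting \<open>a\<close> leaves no universal vertex, then \<open>a'\<close>
    has a non-neighbour \<open>y\<close> among the rest. Deleting \<open>a'\<close> instead removes
    the only non-neighbour of \<open>y\<close>.\<close>
  have "\<exists>c\<in>A. \<exists>b\<in>V - insert c R. V - insert c R - {b} \<subseteq> N b"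
  proof (cases "\<exists>b\<in>V - insert a R. V - insert a R - {b} \<subseteq> N b")
    case True
    then show ?thesis using a by blast
  next
    case False
    moreover have "a' \<in> V - insert a R" using a A(1) by blast
    ultimately obtain y where y: "y \<in> V" "y \<notin> R" "y \<noteq> a'" "y \<notin> N a'" by blast
    have "a' \<in> V" using a A(1) by blast
    have "a' \<notin> N y" using y(4) sym by blast
    have "x \<in> N y" if "x \<in> V - insert a' R - {y}" for x
      using unique[of y x a'] that y \<open>a' \<in> V\<close> \<open>a' \<notin> N y\<close> by blast
    then show ?thesis using a(2) y by blast
  qed
  then obtain c b where c: "c \<in> A" and b: "b \<in> V - insert c R" "V - insert c R - {b} \<subseteq> N b"
    by blast
  let ?S = "V - insert c R - {b}"
  have "insert b (insert c R) \<subseteq> V" "card (insert b (insert c R)) = graph_order T + 1"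
    using R b c A(1) by auto
  moreover have "?S = V - insert b (insert c R)" by blast
  ultimately have card_S: "card ?S = 3"
    using V R(2) by (simp add: card_Diff_subset del: Diff_insert)
  have "connected_on N ?S"
    unfolding connected_on_def
  proof (intro conjI allI impI)
    show "?S \<noteq> {}" using card_S by (metis card.empty zero_neq_numeral)
  next
    fix P assume P: "P \<subseteq> ?S" "P \<noteq> {}" "P \<noteq> ?S"
    then obtain x y where xy: "x \<in> P" "y \<in> ?S" "y \<notin> P" by blast
    \<comment> \<open>Of the three vertices, whichever of \<open>x\<close> and \<open>y\<close> is
      separated from \<open>z\<close> faces the two others and can miss only one of them.\<close>
    have "\<not> ?S \<subseteq> {x, y}"
      using card_S card_mono[of "{x, y}" ?S] card_insert_le_m1[of 2 "{y}" x] by fastforce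
    then obtain z where z: "z \<in> ?S" "z \<noteq> x" "z \<noteq> y" by blast
    have in_V: "x \<in> V" "y \<in> V" "z \<in> V" using xy z P by blast+
    show "\<exists>x\<in>P. \<exists>y\<in>?S - P. y \<in> N x"
    proof (cases "z \<in> P")
      case True
      have "x \<in> N y \<or> z \<in> N y" using unique[of y x z] in_V z xy by blast
      then show ?thesis using True xy sym by blast
    next
      case False
      have "y \<in> N x \<or> z \<in> N x" using unique[of x y z] in_V z xy by blast
      then show ?thesis using False xy z by blast
    qed
  qed
  moreover have "insert c R \<subseteq> V" using c A(1) R(1) by blast
  ultimately show ?thesis using b c A(3) by (intro exI[of _ "insert c R"]) blast
qed

section \<open>Removing a tree from a cograph\<close>

lemma super_edge_connected_delete_universal:
  assumes G: "simple_graph G" and b: "b \<in> vertices G - R" "vertices G - R - {b} \<subseteq> neighbours G b"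
    and con: "connected_on (neighbours G) (vertices G - R - {b})"
  shows "super_edge_connected (delete_vertices G R)"
proof (rule super_edge_connected_universal)
  let ?H = "delete_vertices G R"
  show "simple_graph ?H" using G b(1) by (intro simple_graph_delete_vertices) auto
  show "b \<in> vertices ?H" "vertices ?H - {b} \<subseteq> neighbours ?H b"
    using b by (auto simp: neighbours_delete_vertices)
  show "connected_on (neighbours ?H) (vertices ?H - {b})"
    using con by (subst connected_on_cong[where M = "neighbours G"]) (auto simp: neighbours_delete_vertices)
qed

lemma connected_join_split:
  assumes G: "cograph G" and S: "S \<subseteq> vertices G" "2 \<le> card S"
    and con: "connected_on (neighbours G) S"
  shows "\<exists>P Q. P \<noteq> {} \<and> Q \<noteq> {} \<and> P \<inter> Q = {} \<and> P \<union> Q = S \<and> (\<forall>x\<in>P. \<forall>y\<in>Q. y \<in> neighbours G x)"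
proof -
  obtain P Q where PQ: "P \<noteq> {}" "Q \<noteq> {}" "P \<inter> Q = {}" "P \<union> Q = S"
    and split: "(\<forall>x\<in>P. \<forall>y\<in>Q. y \<in> neighbours G x) \<or> (\<forall>x\<in>P. \<forall>y\<in>Q. y \<notin> neighbours G x)"
    using cograph_split[OF G S] unfolding mem_neighbours by (elim exE conjE)
  have "P \<subseteq> S" "P \<noteq> S" "S - P = Q" using PQ by auto
  then have "\<exists>x\<in>P. \<exists>y\<in>Q. y \<in> neighbours G x"
    using con PQ(1) unfolding connected_on_def by metis
  then show ?thesis using PQ split by blast
qed

text \<open>\<open>P\<close> is the side of the join that contains \<open>z\<close>; being
  nonadjacent to \<open>z\<close>, \<open>z'\<close> lies there too.\<close>

lemma tree_removable_from_connected_cograph: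
  assumes T: "is_tree T" and G: "cograph G" and C: "C \<subseteq> vertices G"
    and con: "connected_on (neighbours G) C"
    and z: "z \<in> C" "z' \<in> C" "z \<noteq> z'" "z' \<notin> neighbours G z"
    and deg: "\<And>v. v \<in> C \<Longrightarrow> graph_order T + 1 \<le> card (neighbours G v \<inter> C)"
  shows "\<exists>R\<subseteq>C. copy_on (neighbours G) T R \<and> connected_on (neighbours G) (C - R) \<and>
    (\<exists>x\<in>C - R. \<exists>y\<in>C - R. x \<noteq> y \<and> y \<notin> neighbours G x) \<and>
    (z \<in> C - R \<or> (\<exists>y\<in>C - R. card (neighbours G y \<inter> (C - R)) \<le> 1))"
proof -
  let ?N = "neighbours G"
  have simple: "simple_graph G" using G by (rule cograph_simple_graph)
  have fin: "finite C" using simple C finite_subset by (auto simp: simple_graph_def)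
  have sym: "\<And>x y. y \<in> ?N x \<Longrightarrow> x \<in> ?N y" by (rule neighbours_sym)
  have irrefl: "\<And>x. x \<notin> ?N x" using simple by (rule neighbours_irrefl)
  have "2 \<le> card C" using card_mono[OF fin, of "{z, z'}"] z by simp
  then obtain A B where AB: "A \<noteq> {}" "B \<noteq> {}" "A \<inter> B = {}" "A \<union> B = C"
    "\<forall>x\<in>A. \<forall>y\<in>B. y \<in> ?N x"
    using connected_join_split[OF G C _ con] by blast
  define P Q where "P = (if z \<in> A then A else B)" and "Q = (if z \<in> A then B else A)"
  have PQ: "Q \<noteq> {}" "P \<inter> Q = {}" "P \<union> Q = C" and zP: "z \<in> P"
    using AB(1-4) z(1) unfolding P_def Q_def by auto
  have join: "y \<in> ?N x" if "x \<in> P" "y \<in> Q" for x y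
    using that AB(5) sym unfolding P_def Q_def by (auto split: if_splits)
  have "z' \<notin> Q" using join[OF zP] z(4) by blast
  then have "z' \<in> P" using z(2) PQ(3) by blast
  then show ?thesis
    using tree_removable_from_join[where N = ?N, OF T, of P Q z z'] fin PQ join zP z deg sym irrefl
    by simp
qed

text \<open>A nonadjacent pair in \<open>C\<close> brings in the join argument. If there is none,
  \<open>C\<close> is a clique and any copy will do, as the degree bound leaves a vertex
  over.\<close>

lemma tree_removable_keeps_connected:
  assumes T: "is_tree T" and G: "cograph G" and C: "C \<subseteq> vertices G"
    and con: "connected_on (neighbours G) C"
    and deg: "\<And>v. v \<in> C \<Longrightarrow> graph_order T + 1 \<le> card (neighbours G v \<inter> C)"
  shows "\<exists>R\<subseteq>C. copy_on (neighbours G) T R \<and> connected_on (neighbours G) (C - R)"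
proof (cases "\<exists>x\<in>C. \<exists>y\<in>C. x \<noteq> y \<and> y \<notin> neighbours G x")
  case True
  then show ?thesis using tree_removable_from_connected_cograph[OF T G C con _ _ _ _ deg] by meson
next
  case clique: False
  let ?N = "neighbours G"
  have simple: "simple_graph G" using G by (rule cograph_simple_graph)
  have fin: "finite C" using simple C finite_subset by (auto simp: simple_graph_def)
  have ne: "C \<noteq> {}" using con by (simp add: connected_on_def)
  then obtain v where v: "v \<in> C" by blast
  have deg': "graph_order T \<le> Suc (card (?N v \<inter> C))" if "v \<in> C" for v using deg[OF that] by simp
  obtain R where R: "R \<subseteq> C" "copy_on ?N T R"
    using tree_embeds[where N = ?N, OF T ne deg' neighbours_sym neighbours_irrefl[OF simple]] by meson
  have "card R < card (?N v \<inter> C)" using deg[OF v] copy_on_card[OF R(2)] by simp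
  also have "\<dots> \<le> card C" using fin by (intro card_mono) auto
  finally have "R \<noteq> C" by blast
  then obtain b where b: "b \<in> C - R" using R(1) by blast
  have "y \<in> ?N b" if "y \<in> C - R - {b}" for y using clique b that by auto
  then have "C - R - {b} \<subseteq> ?N b" by (rule subsetI)
  then have "connected_on ?N (C - R)"
    by (rule connected_on_universal[where N = ?N, OF b _ neighbours_sym])
  then show ?thesis using R by blast
qed

text \<open>After removing the tree, a clique violating super edge-connectivity would have to avoid the
  component \<open>C\<close>, hence be a clique component of \<open>G - b\<close>. Those are larger than the minimum degree
  of \<open>G\<close>, while \<open>C\<close> retains a vertex of degree at most that.\<close>

lemma tree_removable_cut_vertex:
  assumes T: "is_tree T" and G: "cograph G" and super: "super_edge_connected G"
    and delta: "graph_order T + 2 \<le> min_degree G"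
    and b: "b \<in> vertices G" "vertices G - {b} \<subseteq> neighbours G b"
    and discon: "\<not> connected_on (neighbours G) (vertices G - {b})"
  shows "\<exists>R\<subseteq>vertices G. copy_on (neighbours G) T R \<and> super_edge_connected (delete_vertices G R)"
proof -
  let ?V = "vertices G" and ?N = "neighbours G"
  have simple: "simple_graph G" using G by (rule cograph_simple_graph)
  have fin: "finite ?V" using simple by (simp add: simple_graph_def)
  have sym: "\<And>x y. y \<in> ?N x \<Longrightarrow> x \<in> ?N y" by (rule neighbours_sym)
  have irrefl: "\<And>x. x \<notin> ?N x" using simple by (rule neighbours_irrefl)
  have NV: "?N v \<subseteq> ?V" for v using simple by (rule neighbours_subset)
  have deg: "min_degree G \<le> card (?N v)" if "v \<in> ?V" for v using min_degree_le[OF simple that] .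
  \<comment> \<open>Vertices of \<open>D\<close> have degree \<open>card D\<close>, so
    \<open>card D\<close> is at least the minimum degree; equality would contradict the super
    edge-connectedness of \<open>G\<close>.\<close>
  have large_clique_component: "min_degree G < card D"
    if D: "D \<subseteq> ?V - {b}" "D \<noteq> {}" "\<And>x. x \<in> D \<Longrightarrow> ?N x = insert b D - {x}" for D
  proof -
    have "finite D" using D(1) fin finite_subset by blast
    obtain x where x: "x \<in> D" using D(2) by blast
    have "card (?N x) = card D"
      using x D \<open>finite D\<close> by (auto simp: card_insert_if)
    then have le: "min_degree G \<le> card D" using deg[of x] x D(1) by auto
    have "D \<noteq> ?V - {b}"
    proof
      assume "D = ?V - {b}"
      then have "connected_on ?N (?V - {b})"
        using x D(3)[OF x] sym by (intro connected_on_universal[of x]) blast+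
      then show False using discon by blast
    qed
    then have "card D \<noteq> min_degree G"
      using le delta D tree_order_pos[OF T]
      by (intro super_edge_connected_clique_component[OF simple super b]) auto
    then show ?thesis using le by simp
  qed
  obtain z where z: "z \<in> ?V" "card (?N z) = min_degree G"
    using min_degree_attained[OF simple] by blast
  \<comment> \<open>If \<open>b\<close> had minimum degree, \<open>G\<close> would be complete and
    \<open>G - b\<close> connected.\<close>
  have "z \<noteq> b"
  proof
    assume "z = b"
    have Nb: "?N b = ?V - {b}" using b NV[of b] irrefl[of b] by blast
    have full: "?N v = ?V - {v}" if "v \<in> ?V" for v
    proof -
      have "card (?V - {v}) \<le> card (?N v)" using deg[OF that] z(2) Nb that b \<open>z = b\<close> by simp
      moreover have "?N v \<subseteq> ?V - {v}" using NV[of v] irrefl[of v] by blast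
      ultimately show ?thesis using fin by (intro card_seteq) auto
    qed
    have "min_degree G \<noteq> 0" using delta by simp
    then obtain c where "c \<in> ?N b" using z(2) \<open>z = b\<close> by fastforce
    then have "connected_on ?N (?V - {b})"
      using full[of c] Nb sym by (intro connected_on_universal[of c]) blast+
    then show False using discon by blast
  qed
  then have "z \<in> ?V - {b}" using z by blast
  then obtain C where C: "C \<subseteq> ?V - {b}" "z \<in> C" "connected_on ?N C"
    and closed: "\<And>x. x \<in> C \<Longrightarrow> ?N x \<inter> (?V - {b}) \<subseteq> C"
    using component_exists[where N = ?N, OF _ _ sym, of "?V - {b}" z] fin by auto
  have "b \<notin> C" using C(1) by blast
  have finC: "finite C" using C(1) fin finite_subset by blast
  have N_C: "?N x \<subseteq> insert b (?N x \<inter> C)" if "x \<in> C" for x using closed[OF that] NV[of x] by blast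
  have deg_C: "min_degree G \<le> Suc (card (?N x \<inter> C))" if "x \<in> C" for x
  proof -
    have "card (?N x) \<le> card (insert b (?N x \<inter> C))" using N_C[OF that] finC by (intro card_mono) auto
    also have "\<dots> \<le> Suc (card (?N x \<inter> C))" using finC by (simp add: card_insert_if)
    finally show ?thesis using deg[of x] that C(1) by fastforce
  qed
  \<comment> \<open>Otherwise \<open>card C\<close> is the minimum degree. All degrees in
    \<open>C\<close> being at least that, \<open>C\<close> would be a clique component that is too
    small.\<close>
  have "\<exists>z'\<in>C. z \<noteq> z' \<and> z' \<notin> ?N z"
  proof (rule ccontr)
    assume no: "\<not> ?thesis"
    have "b \<in> ?N z" using b z(1) \<open>z \<noteq> b\<close> by (auto intro!: sym[of z b])
    moreover have "x \<in> ?N z" if "x \<in> C" "x \<noteq> z" for x using no that by auto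
    ultimately have "insert b C - {z} \<subseteq> ?N z" by auto
    then have "?N z = insert b C - {z}" using N_C[OF C(2)] irrefl[of z] by blast
    then have card_C: "card C = min_degree G"
      using z(2) C(2) finC \<open>b \<notin> C\<close> by simp
    have N_eq: "?N x = insert b C - {x}" if x: "x \<in> C" for x
    proof -
      have "card (insert b C - {x}) = card C" using x finC \<open>b \<notin> C\<close> by simp
      then have "card (insert b C - {x}) \<le> card (?N x)" using deg[of x] card_C x C(1) by auto
      moreover have "?N x \<subseteq> insert b C - {x}" using N_C[OF x] irrefl[of x] by blast
      ultimately show ?thesis using finC by (intro card_seteq) auto
    qed
    have "C \<noteq> {}" using C(2) by blast
    then have "min_degree G < card C" using C(1) N_eq by (intro large_clique_component)
    then show False using card_C by simp
  qed
  then obtain z' where z': "z' \<in> C" "z \<noteq> z'" "z' \<notin> ?N z" by blast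
  have deg': "graph_order T + 1 \<le> card (?N v \<inter> C)" if "v \<in> C" for v
    using deg_C[OF that] delta by simp
  have "C \<subseteq> ?V" using C(1) by blast
  obtain R where R: "R \<subseteq> C" "copy_on ?N T R" "connected_on ?N (C - R)"
    and nonadj: "\<exists>x\<in>C - R. \<exists>y\<in>C - R. x \<noteq> y \<and> y \<notin> ?N x"
    and low: "z \<in> C - R \<or> (\<exists>y\<in>C - R. card (?N y \<inter> (C - R)) \<le> 1)"
    using tree_removable_from_connected_cograph[OF T G \<open>C \<subseteq> ?V\<close> C(3,2) z' deg'] by meson
  let ?S = "?V - R" and ?H = "delete_vertices G R"
  have bS: "b \<in> ?S" "?S - {b} \<subseteq> ?N b" using b R(1) C(1) by auto
  \<comment> \<open>A vertex of degree at most 1 in \<open>C - R\<close> gains only the neighbour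
    \<open>b\<close>, and 2 is below the minimum degree of \<open>G\<close>.\<close>
  have low_degree: "\<exists>y\<in>?S. card (?N y \<inter> ?S) \<le> min_degree G"
    using low
  proof
    assume "z \<in> C - R"
    moreover have "card (?N z \<inter> ?S) \<le> card (?N z)"
      using NV[of z] fin finite_subset by (intro card_mono) auto
    ultimately show ?thesis using z by (intro bexI[of _ z]) auto
  next
    assume "\<exists>y\<in>C - R. card (?N y \<inter> (C - R)) \<le> 1"
    then obtain y where y: "y \<in> C - R" "card (?N y \<inter> (C - R)) \<le> 1" by blast
    have "?N y \<inter> ?S \<subseteq> insert b (?N y \<inter> (C - R))" using N_C[of y] y by blast
    then have "card (?N y \<inter> ?S) \<le> card (insert b (?N y \<inter> (C - R)))"
      using finC by (intro card_mono) auto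
    also have "\<dots> \<le> 2" using y(2) finC by (auto simp: card_insert_if)
    finally show ?thesis using y C(1) delta by (intro bexI[of _ y]) auto
  qed
  have tight: "\<not> tight_clique ?N ?S D" for D
  proof
    assume D: "tight_clique ?N ?S D"
    have out: "b \<notin> D" "\<And>x. x \<in> D \<Longrightarrow> ?N x \<inter> (?S - D) = {b}"
      using tight_clique_universal[OF D bS] sym by blast+
    have DS: "D \<subseteq> ?S" "D \<noteq> {}" and clique: "\<And>x. x \<in> D \<Longrightarrow> D - {x} \<subseteq> ?N x"
      using D by (auto simp: tight_clique_def)
    have N_D: "?N x \<inter> ?S \<subseteq> insert b D" if "x \<in> D" for x using out(2)[OF that] by blast
    \<comment> \<open>Since \<open>C - R\<close> is connected and \<open>D\<close> has no outside
      neighbour but \<open>b\<close>, a clique \<open>D\<close> meeting \<open>C\<close> would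
      contain \<open>C - R\<close> and its nonadjacent pair.\<close>
    have "D \<inter> C = {}"
    proof (rule ccontr)
      assume "D \<inter> C \<noteq> {}"
      have "C - R \<subseteq> D"
      proof (rule ccontr)
        assume "\<not> C - R \<subseteq> D"
        then have "D \<inter> C \<subseteq> C - R" "D \<inter> C \<noteq> C - R" using DS by blast+
        then obtain x y where "x \<in> D \<inter> C" "y \<in> C - R - D \<inter> C" "y \<in> ?N x"
          using R(3) \<open>D \<inter> C \<noteq> {}\<close> unfolding connected_on_def by meson
        moreover from this have "y \<in> ?S" "y \<noteq> b" using C(1) by auto
        ultimately show False using N_D[of x] by blast
      qed
      then show False using nonadj clique by blast
    qed
    \<comment> \<open>The tree was taken from another component, so vertices of \<open>D\<close>
      lost no neighbours.\<close>
    have N_eq: "?N x = insert b D - {x}" if x: "x \<in> D" for x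
    proof
      have "x \<notin> C" "x \<noteq> b" "x \<in> ?V" using x \<open>D \<inter> C = {}\<close> out(1) DS by auto
      have "y \<notin> C" if "y \<in> ?N x" for y
        using closed[of y] sym[OF that] \<open>x \<notin> C\<close> \<open>x \<noteq> b\<close> \<open>x \<in> ?V\<close> by blast
      then have "?N x \<subseteq> ?S" using NV[of x] R(1) by blast
      then show "?N x \<subseteq> insert b D - {x}" using N_D[OF x] irrefl[of x] by blast
      show "insert b D - {x} \<subseteq> ?N x" using clique[OF x] out(2)[OF x] by blast
    qed
    have "D \<subseteq> ?V - {b}" using out(1) DS(1) by blast
    then have "min_degree G < card D" using DS(2) N_eq by (intro large_clique_component)
    moreover have "card D \<le> min_degree G"
      using low_degree D unfolding tight_clique_def by (meson le_trans)
    ultimately show False by simp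
  qed
  have H: "simple_graph ?H" using simple bS(1) by (intro simple_graph_delete_vertices) auto
  have NH: "neighbours ?H v = ?N v \<inter> ?S" if "v \<in> ?S" for v
    using that NV[of v] by (auto simp: neighbours_delete_vertices)
  have "super_edge_connected ?H"
  proof (rule super_edge_connectedI[OF H])
    have bH: "b \<in> vertices ?H" "vertices ?H - {b} \<subseteq> neighbours ?H b"
      using bS NH[OF bS(1)] by auto
    show "connected_on (neighbours ?H) (vertices ?H)" "diameter_le_2 (neighbours ?H) (vertices ?H)"
      using connected_on_universal[where N = "neighbours ?H", OF bH neighbours_sym]
        diameter_le_2_universal[where N = "neighbours ?H", OF bH neighbours_sym]
      by blast+
    obtain x y where xy: "x \<in> C - R" "y \<in> C - R" "x \<noteq> y" using nonadj by blast
    then have "card {x, y} \<le> card ?S" using C(1) fin by (intro card_mono) auto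
    then show "2 \<le> card (vertices ?H)" using xy(3) by simp
    fix D
    have "tight_clique (neighbours ?H) ?S D \<longleftrightarrow> tight_clique ?N ?S D"
    proof (cases "D \<subseteq> ?S")
      case True
      have "neighbours ?H v \<inter> ?S = ?N v \<inter> ?S" "neighbours ?H v \<inter> (?S - D) = ?N v \<inter> (?S - D)"
        "D - {v} \<subseteq> neighbours ?H v \<longleftrightarrow> D - {v} \<subseteq> ?N v" if "v \<in> ?S" for v
        using NH[OF that] True by auto
      then show ?thesis using True unfolding tight_clique_def by (auto simp: subset_iff)
    qed (simp add: tight_clique_def)
    then show "\<not> tight_clique (neighbours ?H) (vertices ?H) D" using tight by simp
  qed
  then show ?thesis using R(1,2) C(1) by blast
qed

text \<open>A side with a single vertex would make that vertex universal, so both sides of the join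
  have two vertices to reserve.\<close>

lemma tree_removable_no_universal:
  assumes T: "is_tree T" and G: "cograph G" and con: "graph_connected G"
    and delta: "graph_order T + 2 \<le> min_degree G"
    and no_universal: "\<And>b. b \<in> vertices G \<Longrightarrow> \<not> vertices G - {b} \<subseteq> neighbours G b"
  shows "\<exists>R\<subseteq>vertices G. copy_on (neighbours G) T R \<and> super_edge_connected (delete_vertices G R)"
proof -
  let ?V = "vertices G" and ?N = "neighbours G"
  have simple: "simple_graph G" using G by (rule cograph_simple_graph)
  have fin: "finite ?V" using simple by (simp add: simple_graph_def)
  have sym: "\<And>x y. y \<in> ?N x \<Longrightarrow> x \<in> ?N y" by (rule neighbours_sym)
  have irrefl: "\<And>x. x \<notin> ?N x" using simple by (rule neighbours_irrefl)
  have NV: "?N v \<subseteq> ?V" for v using simple by (rule neighbours_subset)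
  have deg: "graph_order T + 2 \<le> card (?N v \<inter> ?V)" if "v \<in> ?V" for v
    using min_degree_le[OF simple that] delta NV[of v] by (simp add: Int_absorb2)
  obtain v where v: "v \<in> ?V" using simple by (auto simp: simple_graph_def)
  obtain v' where v': "v' \<in> ?V" "v' \<noteq> v" "v' \<notin> ?N v" using no_universal[OF v] by blast
  \<comment> \<open>A vertex, a non-neighbour and at least \<open>graph_order T + 2\<close>
    neighbours: the order is at least \<open>graph_order T + 4\<close>.\<close>
  have "card (insert v (insert v' (?N v \<inter> ?V))) \<le> card ?V"
    using fin v v' by (intro card_mono) auto
  then have card_V: "graph_order T + 4 \<le> card ?V"
    using deg[OF v] v' irrefl[of v] fin by simp
  then have two_V: "2 \<le> card ?V" by simp
  have con_V: "connected_on ?N ?V" using con simple_graph_connected_iff[OF simple] by simp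
  obtain P Q where PQ: "P \<noteq> {}" "Q \<noteq> {}" "P \<inter> Q = {}" "P \<union> Q = ?V"
    and "\<forall>x\<in>P. \<forall>y\<in>Q. y \<in> ?N x"
    using connected_join_split[OF G order_refl two_V con_V] by (elim exE conjE)
  then have join: "\<And>x y. x \<in> P \<Longrightarrow> y \<in> Q \<Longrightarrow> y \<in> ?N x" by blast
  have finPQ: "finite P" "finite Q" using fin PQ(4) by (metis finite_Un)+
  have "card P \<noteq> 1"
  proof
    assume "card P = 1"
    then obtain b where "P = {b}" by (auto simp: card_1_singleton_iff)
    then show False using no_universal[of b] PQ join by blast
  qed
  moreover have "card Q \<noteq> 1"
  proof
    assume "card Q = 1"
    then obtain b where "Q = {b}" by (auto simp: card_1_singleton_iff)
    then show False using no_universal[of b] PQ join sym by blast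
  qed
  moreover have "card P \<noteq> 0" "card Q \<noteq> 0" using PQ finPQ by auto
  ultimately have two: "2 \<le> card P" "2 \<le> card Q" by linarith+
  show ?thesis
  proof (cases "graph_order T + 5 \<le> card ?V")
    case True
    then obtain R where R: "R \<subseteq> ?V" "copy_on ?N T R" "2 \<le> card (P - R)" "2 \<le> card (Q - R)"
      using tree_removable_large_join[where N = ?N and P = P and Q = Q, OF T _ PQ(3) two _ _ sym irrefl]
        fin deg unfolding PQ(4) by blast
    have "card ?V - card R \<le> card (?V - R)"
      using R(1) fin finite_subset by (intro diff_card_le_card_Diff) blast
    then have "5 \<le> card (?V - R)" using True copy_on_card[OF R(2)] by simp
    moreover from this have "?V - R \<noteq> {}" by (metis card.empty not_numeral_le_zero)
    ultimately have "super_edge_connected (delete_vertices G R)"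
      using R PQ join simple
      by (intro super_edge_connected_join[of _ "P - R" "Q - R"] simple_graph_delete_vertices)
        (auto simp: neighbours_delete_vertices)
    then show ?thesis using R by blast
  next
    case False
    then have "card ?V = graph_order T + 4" using card_V by simp
    then show ?thesis
      using tree_removable_cocktail_party[where N = ?N, OF T fin _ deg sym irrefl]
        super_edge_connected_delete_universal[OF simple] by meson
  qed
qed

theorem theorem14:
  fixes m :: nat and T :: "'b sgraph" and G :: "'a sgraph"
  assumes "m \<ge> 1"
    and "is_tree T" and "graph_order T = m"
    and "simple_graph G" and "cograph G"
    and "super_edge_connected G" and "min_degree G \<ge> m + 2"
  shows "\<exists>T'. is_tree T' \<and> subgraph_of T' G \<and> graph_isomorphic T' T \<and>
    super_edge_connected (delete_vertices G (vertices T'))"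
proof -
  let ?V = "vertices G" and ?N = "neighbours G"
  have delta: "graph_order T + 2 \<le> min_degree G" using assms(3,7) by simp
  have deg: "graph_order T + 2 \<le> card (?N v)" if "v \<in> ?V" for v
    using min_degree_le[OF assms(4) that] delta by simp
  \<comment> \<open>If disconnected, \<open>G\<close> would have an isolated vertex, against the
    positive minimum degree.\<close>
  have con: "graph_connected G"
  proof (rule ccontr)
    assume "\<not> graph_connected G"
    then obtain v where "v \<in> ?V" "vertex_degree G v = 0"
      using assms(6) by (auto simp: super_edge_connected_def)
    then show False using deg[of v] by (simp add: vertex_degree_def)
  qed
  have "\<exists>R\<subseteq>?V. copy_on ?N T R \<and> super_edge_connected (delete_vertices G R)"
  proof (cases "\<exists>b\<in>?V. ?V - {b} \<subseteq> ?N b")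
    case True
    then obtain b where b: "b \<in> ?V" "?V - {b} \<subseteq> ?N b" by blast
    show ?thesis
    proof (cases "connected_on ?N (?V - {b})")
      case True
      \<comment> \<open>Leaving out \<open>b\<close> costs each vertex one neighbour.\<close>
      have deg': "graph_order T + 1 \<le> card (?N v \<inter> (?V - {b}))" if "v \<in> ?V - {b}" for v
      proof -
        have "?N v \<inter> (?V - {b}) = ?N v - {b}" using neighbours_subset[OF assms(4), of v] by blast
        moreover have "card (?N v) - 1 \<le> card (?N v - {b})" by (simp add: card_Diff_singleton_if)
        moreover have "graph_order T + 2 \<le> card (?N v)" using deg that by blast
        ultimately show ?thesis by simp
      qed
      obtain R where R: "R \<subseteq> ?V - {b}" "copy_on ?N T R" "connected_on ?N (?V - {b} - R)"
        using tree_removable_keeps_connected[OF assms(2,5) Diff_subset True deg'] by meson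
      moreover have "?V - {b} - R = ?V - R - {b}" by blast
      ultimately have "super_edge_connected (delete_vertices G R)"
        using b by (intro super_edge_connected_delete_universal[OF assms(4), of b]) auto
      then show ?thesis using R by blast
    next
      case False
      show ?thesis by (rule tree_removable_cut_vertex[OF assms(2,5,6) delta b False])
    qed
  next
    case False
    then show ?thesis using tree_removable_no_universal[OF assms(2,5) con delta] by blast
  qed
  then show ?thesis using copy_on_tree[OF assms(2)] by metis
qed

end
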